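(* In the combinatorial Marker-Cutter game (with any initial counter $g_0$), if Marker has a strategy against restricted Cutter limiting the value of each game state to at most $t$, then Marker also has a strategy against (unrestricted) Cutter limiting the value of each game state to at most $t$.
   Context: A set of boundary cycles is a pair $(D,\chi)$: $D$ a finite directed graph each of whose components is a directed cycle (loops allowed, no isolated vertices), $\chi:E(D)\to L$ an edge labelling; it is proper if each label is used on at most two edges. The value $v(D,\chi)$ is the number of labels used. A game state is $\gamma=(D,\chi,g)$ with $(D,\chi)$ proper and $g\in\mathbb N_0$; $v(\gamma)=v(D,\chi)$. Combinatorial Marker-Cutter game: start with $D_0$ empty, $\chi_0$ empty, counter $g_0\in\mathbb N$. At turn $k$ with state $(D_k,\chi_k,g_k)$, Marker chooses $v,w$ (not necessarily distinct) from $V(D_k)\sqcup\{v_\gamma,w_\gamma\}$ ($v_\gamma,w_\gamma$ dummy vertices; each chosen dummy vertex, without multiplicity, is added as a new vertex). Let $C,C'$ be the components containing $v,w$ (a cycle or a single dummy vertex). Splitting a vertex $u$ replaces it by a source $u_1$ (incident to the out-edge) and a sink $u_2$ (incident to the in-edge). If $C=C'$: splitting $v$ and $w$ turns $C$ into a directed path $P$ from $v_1$ to $w_2$ and a directed path $P'$ from $w_1$ to $v_2$ (if $v=w$ is dummy, $v_1=w_2$, $v_2=w_1$ and the paths are trivial); add new edges $f=\overrightarrow{w_2v_1}$, $f'=\overrightarrow{v_2w_1}$, $\hat C_1=P\cup\{f\}$, $\hat C_2=P'\cup\{f'\}$; Cutter chooses (a) $D_{k+1}=\bar D\cup\hat C_1\cup\hat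 C_2$, $g_{k+1}=g_k-1$ (only if $g_k\ge1$); (b) $D_{k+1}=\bar D\cup\hat C_1$, $g_{k+1}=\bar g$; or (c) $D_{k+1}=\bar D\cup\hat C_2$, $g_{k+1}=\bar g$; where $\bar D$ is any union of components of $D_k\setminus C$ and $0\le\bar g\le g_k$. If $C\ne C'$: splitting turns $C$ into a path $P$ from $v_1$ to $v_2$ (trivial if $v$ dummy) and $C'$ into $P'$ from $w_1$ to $w_2$; new edges $f=\overrightarrow{w_2v_1}$, $f'=\overrightarrow{v_2w_1}$, $\hat C=P\cup P'\cup\{f,f'\}$; the only move is (d) $D_{k+1}=(D_k\cup\hat C)\setminus(C\cup C')$, $g_{k+1}=g_k$. In all cases $\chi_{k+1}$ extends $\chi_k$ and the new edges present receive one common new label not in the image of $\chi_k$. A contraction of $(D,\chi)$ contracts one edge of $D$ (deleting resulting isolated vertices). $(D',\chi',g')$ is a reduction of $(D,\chi,g)$ if $g'\le g$, $D'$ is obtained from $D$ by a sequence of contractions and $\chi'=\chi$ on $E(D')$. Two game states $(D,\chi,g)$ and $(D',\chi',g)$ are equivalent if there is an isomorphism $\psi:D\to D'$ of directed graphs and a bijection $\phi$ between their label sets with $\chi'\circ\psi=\phi\circ\chi$. Restricted Cutter is a Cutter who may never make a move producing a game state equivalent to a reduction of an earlier game state (including the current one), and who in moves (a), (b), (c) must take $\bar D=D_k\setminus C$ and $\bar g=g_k$; if restricted Cutter has no legal move, the game ends. *)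

theory Defs
  imports "Graph_Theory.Digraph_Isomorphism" "HOL-Library.Infinite_Typeclass"
begin

section \<open>Sets of boundary cycles and game states\<close>

text \<open>Components are weak components and are represented by their vertex sets.\<close>

definition component :: "('v, 'e) pre_digraph \<Rightarrow> 'v \<Rightarrow> 'v set" where
  "component D v = {u. v \<rightarrow>\<^sup>*\<^bsub>with_proj (mk_symmetric D)\<^esub> u}"

definition components :: "('v, 'e) pre_digraph \<Rightarrow> 'v set set" where
  "components D = component D ` verts D"

definition directed_cycle :: "('v, 'e) pre_digraph \<Rightarrow> bool" where
  "directed_cycle C \<longleftrightarrow>
    (\<exists>p. pre_digraph.cycle C p \<and> arcs C = set p \<and> verts C = tail C ` set p)"

definition boundary_cycles :: "('v, 'e) pre_digraph \<Rightarrow> bool" where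
  "boundary_cycles D \<longleftrightarrow> fin_digraph D \<and> (\<forall>C \<in> components D. directed_cycle (D \<restriction> C))"

definition proper :: "('v, 'e) pre_digraph \<Rightarrow> ('e \<Rightarrow> 'l) \<Rightarrow> bool" where
  "proper D \<chi> \<longleftrightarrow> (\<forall>l. card {e \<in> arcs D. \<chi> e = l} \<le> 2)"

text \<open>
  A triple of a digraph, a labelling (only its values on the arcs of the digraph matter) and
  the counter.
\<close>

type_synonym ('v, 'e, 'l) config = "('v, 'e) pre_digraph \<times> ('e \<Rightarrow> 'l) \<times> nat"

definition game_state :: "('v, 'e, 'l) config \<Rightarrow> bool" where
  "game_state = (\<lambda>(D, \<chi>, g). boundary_cycles D \<and> proper D \<chi>)"

definition state_value :: "('v, 'e, 'l) config \<Rightarrow> nat" where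
  "state_value = (\<lambda>(D, \<chi>, g). card (\<chi> ` arcs D))"


section \<open>Reductions and equivalence\<close>

text \<open>
  Contracting \<open>e\<close> merges its head into its tail and removes the merged vertex if it has become
  isolated, which happens precisely if \<open>e\<close> was the only edge of its component.
\<close>

definition contract_edge :: "('v, 'e) pre_digraph \<Rightarrow> 'e \<Rightarrow> ('v, 'e) pre_digraph" where
  "contract_edge D e =
    (let r = (\<lambda>x. if x = head D e then tail D e else x);
         A = arcs D - {e};
         t = (\<lambda>a. r (tail D a));
         h = (\<lambda>a. r (head D a))
     in \<lparr>verts = {x \<in> r ` verts D. x = tail D e \<longrightarrow> (\<exists>a \<in> A. t a = x \<or> h a = x)},
         arcs = A, tail = t, head = h\<rparr>)"

definition contraction :: "('v, 'e) pre_digraph \<Rightarrow> ('v, 'e) pre_digraph \<Rightarrow> bool" where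
  "contraction D D' \<longleftrightarrow> (\<exists>e \<in> arcs D. D' = contract_edge D e)"

definition reduction :: "('v, 'e, 'l) config \<Rightarrow> ('v, 'e, 'l) config \<Rightarrow> bool" where
  "reduction = (\<lambda>(D', \<chi>', g') (D, \<chi>, g).
     g' \<le> g \<and> contraction\<^sup>*\<^sup>* D D' \<and> (\<forall>e \<in> arcs D'. \<chi>' e = \<chi> e))"

definition equivalent :: "('v, 'e, 'l) config \<Rightarrow> ('v, 'e, 'l) config \<Rightarrow> bool" where
  "equivalent = (\<lambda>(D, \<chi>, g) (D', \<chi>', g').
     g = g' \<and>
     (\<exists>\<psi> \<phi>. pre_digraph.digraph_isomorphism D \<psi> \<and> D' = app_iso \<psi> D \<and>
        bij_betw \<phi> (\<chi> ` arcs D) (\<chi>' ` arcs D') \<and>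
        (\<forall>e \<in> arcs D. \<chi>' (iso_arcs \<psi> e) = \<phi> (\<chi> e))))"


section \<open>Marker's choices\<close>

definition dummies :: "('v, 'e) pre_digraph \<Rightarrow> 'v \<times> 'v" where
  "dummies D = (SOME (x, y). x \<noteq> y \<and> x \<notin> verts D \<and> y \<notin> verts D)"

definition marker_choices :: "('v, 'e, 'l) config \<Rightarrow> ('v \<times> 'v) set" where
  "marker_choices = (\<lambda>(D, \<chi>, g).
     let V = verts D \<union> {fst (dummies D), snd (dummies D)} in V \<times> V)"

definition add_points :: "('v, 'e) pre_digraph \<Rightarrow> 'v \<Rightarrow> 'v \<Rightarrow> ('v, 'e) pre_digraph" where
  "add_points D v w = D\<lparr>verts := verts D \<union> {v, w}\<rparr>"


section \<open>Splitting and gluing\<close>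

text \<open>The source is incident to the out-edges, the sink to the in-edges.\<close>

definition split_vertex :: "('v, 'e) pre_digraph \<Rightarrow> 'v \<Rightarrow> 'v \<Rightarrow> 'v \<Rightarrow> ('v, 'e) pre_digraph" where
  "split_vertex D v source sink =
    \<lparr>verts = (verts D - {v}) \<union> {source, sink}, arcs = arcs D,
     tail = (\<lambda>e. if tail D e = v then source else tail D e),
     head = (\<lambda>e. if head D e = v then sink else head D e)\<rparr>"

definition add_edge :: "('v, 'e) pre_digraph \<Rightarrow> 'e \<Rightarrow> 'v \<Rightarrow> 'v \<Rightarrow> ('v, 'e) pre_digraph" where
  "add_edge D f x y =
    \<lparr>verts = verts D, arcs = insert f (arcs D), tail = (tail D)(f := x), head = (head D)(f := y)\<rparr>"

text \<open>
  For \<open>v \<noteq> w\<close>, both points are split; a dummy vertex yields a trivial path, that is, its source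
  and its sink are the same vertex.

  For \<open>v = w\<close>, one of the two paths runs once around the component of \<open>v\<close> (from the source
  \<open>v\<^sub>1\<close> to the sink \<open>w\<^sub>2\<close> of \<open>v\<close>) and the other one is trivial, consisting of a new
  vertex \<open>v\<^sub>2 = w\<^sub>1\<close>. If \<open>v = w\<close> is a dummy vertex, then the first path is trivial as
  well. Interchanging the two paths would only interchange moves (b) and (c).
\<close>

definition fresh_split ::
  "('v, 'e) pre_digraph \<Rightarrow> 'v \<Rightarrow> 'v \<Rightarrow> 'v \<Rightarrow> 'v \<Rightarrow> 'v \<Rightarrow> 'v \<Rightarrow> bool" where
  "fresh_split D v w v\<^sub>1 v\<^sub>2 w\<^sub>1 w\<^sub>2 \<longleftrightarrow>
     {v\<^sub>1, v\<^sub>2, w\<^sub>1, w\<^sub>2} \<inter> (verts D \<union> {v, w}) = {} \<and>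
     (if v = w
      then v\<^sub>2 = w\<^sub>1 \<and> v\<^sub>2 \<notin> {v\<^sub>1, w\<^sub>2} \<and> (v\<^sub>1 = w\<^sub>2 \<longleftrightarrow> v \<notin> verts D)
      else {v\<^sub>1, v\<^sub>2} \<inter> {w\<^sub>1, w\<^sub>2} = {} \<and>
           (v\<^sub>1 = v\<^sub>2 \<longleftrightarrow> v \<notin> verts D) \<and> (w\<^sub>1 = w\<^sub>2 \<longleftrightarrow> w \<notin> verts D))"

definition split_points ::
  "('v, 'e) pre_digraph \<Rightarrow> 'v \<Rightarrow> 'v \<Rightarrow> 'v \<Rightarrow> 'v \<Rightarrow> 'v \<Rightarrow> 'v \<Rightarrow> ('v, 'e) pre_digraph" where
  "split_points D v w v\<^sub>1 v\<^sub>2 w\<^sub>1 w\<^sub>2 =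
    (if v = w
     then (let S = split_vertex (add_points D v w) v v\<^sub>1 w\<^sub>2 in S\<lparr>verts := insert v\<^sub>2 (verts S)\<rparr>)
     else split_vertex (split_vertex (add_points D v w) v v\<^sub>1 v\<^sub>2) w w\<^sub>1 w\<^sub>2)"

text \<open>
  \<open>cut D \<chi> v w P P' E \<chi>'\<close>: splitting \<open>v\<close> and \<open>w\<close> and adding both new edges, with a common new
  label, turns \<open>D\<close> into \<open>E\<close> and \<open>\<chi>\<close> into \<open>\<chi>'\<close>. Here \<open>P\<close> and \<open>P'\<close> are the vertex sets of the
  components of \<open>v\<^sub>1\<close> and \<open>v\<^sub>2\<close> after splitting and before adding the edges; they are only
  used if \<open>v\<close> and \<open>w\<close> are in the same component, and are then the two paths of the
  definition of the game. In this case \<open>P\<close> and \<open>P'\<close> induce in \<open>E\<close> the two new cycles.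
\<close>

definition cut ::
  "('v, 'e) pre_digraph \<Rightarrow> ('e \<Rightarrow> 'l) \<Rightarrow> 'v \<Rightarrow> 'v \<Rightarrow>
   'v set \<Rightarrow> 'v set \<Rightarrow> ('v, 'e) pre_digraph \<Rightarrow> ('e \<Rightarrow> 'l) \<Rightarrow> bool" where
  "cut D \<chi> v w P P' E \<chi>' \<longleftrightarrow>
    (\<exists>v\<^sub>1 v\<^sub>2 w\<^sub>1 w\<^sub>2 f f' l.
       fresh_split D v w v\<^sub>1 v\<^sub>2 w\<^sub>1 w\<^sub>2 \<and>
       f \<notin> arcs D \<and> f' \<notin> arcs D \<and> f \<noteq> f' \<and> l \<notin> \<chi> ` arcs D \<and>
       (let S = split_points D v w v\<^sub>1 v\<^sub>2 w\<^sub>1 w\<^sub>2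
        in P = component S v\<^sub>1 \<and> P' = component S v\<^sub>2 \<and>
           E = add_edge (add_edge S f w\<^sub>2 v\<^sub>1) f' v\<^sub>2 w\<^sub>1) \<and>
       \<chi>' = \<chi>(f := l, f' := l))"


section \<open>Cutter's moves\<close>

definition same_component :: "('v, 'e) pre_digraph \<Rightarrow> 'v \<Rightarrow> 'v \<Rightarrow> bool" where
  "same_component D v w \<longleftrightarrow> component (add_points D v w) v = component (add_points D v w) w"

definition other_components :: "('v, 'e) pre_digraph \<Rightarrow> 'v \<Rightarrow> 'v \<Rightarrow> 'v set set" where
  "other_components D v w =
     components (add_points D v w) - {component (add_points D v w) v}"

text \<open>
  The family \<open>K\<close> consists of the components whose union is the digraph written \<open>D\<close> with a bar,
  and \<open>h\<close> is the counter written \<open>g\<close> with a bar. The names of new vertices and edges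
  and the new label are arbitrary, subject to freshness; in the game, vertices, edges
  and labels are drawn from infinite types, so that fresh ones always exist.
\<close>

inductive cutter_turn ::
  "('v, 'e, 'l) config \<Rightarrow> 'v \<times> 'v \<Rightarrow> 'v set set \<Rightarrow> nat \<Rightarrow> ('v, 'e, 'l) config \<Rightarrow> bool" where
  move_a: "cutter_turn (D, \<chi>, g) (v, w) K h (E \<restriction> (\<Union>K \<union> P \<union> P'), \<chi>', g - 1)"
    if "cut D \<chi> v w P P' E \<chi>'" "same_component D v w" "K \<subseteq> other_components D v w" "1 \<le> g"
| move_b: "cutter_turn (D, \<chi>, g) (v, w) K h (E \<restriction> (\<Union>K \<union> P), \<chi>', h)"
    if "cut D \<chi> v w P P' E \<chi>'" "same_component D v w" "K \<subseteq> other_components D v w" "h \<le> g"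
| move_c: "cutter_turn (D, \<chi>, g) (v, w) K h (E \<restriction> (\<Union>K \<union> P'), \<chi>', h)"
    if "cut D \<chi> v w P P' E \<chi>'" "same_component D v w" "K \<subseteq> other_components D v w" "h \<le> g"
| move_d: "cutter_turn (D, \<chi>, g) (v, w) K h (E, \<chi>', g)"
    if "cut D \<chi> v w P P' E \<chi>'" "\<not> same_component D v w"

text \<open>
  Rules for Cutter: which states may follow a history (the nonempty list of all
  states so far, the current one being the last) and a choice of Marker.
\<close>

type_synonym ('v, 'e, 'l) cutter_rules =
  "('v, 'e, 'l) config list \<Rightarrow> 'v \<times> 'v \<Rightarrow> ('v, 'e, 'l) config \<Rightarrow> bool"

definition unrestricted_cutter :: "('v, 'e, 'l) cutter_rules" where
  "unrestricted_cutter H m s \<longleftrightarrow> (\<exists>K h. cutter_turn (last H) m K h s)"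

definition restricted_cutter :: "('v, 'e, 'l) cutter_rules" where
  "restricted_cutter H m s \<longleftrightarrow>
     (case last H of (D, \<chi>, g) \<Rightarrow>
        cutter_turn (D, \<chi>, g) m (other_components D (fst m) (snd m)) g s) \<and>
     \<not> (\<exists>s\<^sub>0 \<in> set H. \<exists>r. reduction r s\<^sub>0 \<and> equivalent s r)"


section \<open>Plays and strategies\<close>

definition initial_state :: "nat \<Rightarrow> ('v, 'e, 'l) config" where
  "initial_state g\<^sub>0 =
    (\<lparr>verts = {}, arcs = {}, tail = (\<lambda>_. undefined), head = (\<lambda>_. undefined)\<rparr>,
     \<lambda>_. undefined, g\<^sub>0)"

type_synonym ('v, 'e, 'l) strategy = "('v, 'e, 'l) config list \<Rightarrow> 'v \<times> 'v"

inductive play ::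
  "('v, 'e, 'l) cutter_rules \<Rightarrow> ('v, 'e, 'l) strategy \<Rightarrow> nat \<Rightarrow> ('v, 'e, 'l) config list \<Rightarrow> bool"
  for R :: "('v, 'e, 'l) cutter_rules" and \<sigma> :: "('v, 'e, 'l) strategy" and g\<^sub>0 :: nat where
  play_start: "play R \<sigma> g\<^sub>0 [initial_state g\<^sub>0]"
| play_turn: "play R \<sigma> g\<^sub>0 H \<Longrightarrow> R H (\<sigma> H) s \<Longrightarrow> play R \<sigma> g\<^sub>0 (H @ [s])"

text \<open>
  Infinite plays are covered by their finite initial segments; a play in which Cutter is stuck
  just has no continuation.
\<close>

definition limits_value ::
  "('v, 'e, 'l) cutter_rules \<Rightarrow> ('v, 'e, 'l) strategy \<Rightarrow> nat \<Rightarrow> nat \<Rightarrow> bool" where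
  "limits_value R \<sigma> g\<^sub>0 t \<longleftrightarrow>
     (\<forall>H. play R \<sigma> g\<^sub>0 H \<longrightarrow>
        \<sigma> H \<in> marker_choices (last H) \<and> (\<forall>s \<in> set H. state_value s \<le> t))"


section \<open>Every state occurring in a play is a game state\<close>

text \<open>
  The definitions above do not ask for this: it is a consequence of the rules. The proof uses that
  a finite digraph is a disjoint union of directed cycles iff all in- and out-degrees are 1.
\<close>


definition deg_one :: "('v, 'e) pre_digraph \<Rightarrow> bool" where
  "deg_one D \<longleftrightarrow> bij_betw (tail D) (arcs D) (verts D) \<and> bij_betw (head D) (arcs D) (verts D)"

definition nbr :: "('v, 'e) pre_digraph \<Rightarrow> ('v \<times> 'v) set" where
  "nbr D = {(x, y). \<exists>e \<in> arcs D. {x, y} = {tail D e, head D e}}"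

lemma component_conv:
  assumes "wf_digraph D" "v \<in> verts D"
  shows "component D v = {u. (v, u) \<in> (nbr D)\<^sup>*}"
proof -
  have *: "arcs_ends (with_proj (mk_symmetric D)) = nbr D"
    by (auto simp: arcs_ends_conv parcs_mk_symmetric nbr_def doubleton_eq_iff)
  have sub: "nbr D \<subseteq> verts D \<times> verts D"
    using assms by (auto simp: nbr_def doubleton_eq_iff wf_digraph.tail_in_verts wf_digraph.head_in_verts)
  have "(v,u) \<in> rtrancl_on (verts D) (nbr D) \<longleftrightarrow> (v,u) \<in> (nbr D)\<^sup>*" for u
  proof
    assume "(v,u) \<in> rtrancl_on (verts D) (nbr D)" then show "(v,u) \<in> (nbr D)\<^sup>*"
      by (rule rtrancl_on_rtranclI)
  next
    assume "(v,u) \<in> (nbr D)\<^sup>*" then show "(v,u) \<in> rtrancl_on (verts D) (nbr D)"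
    proof induction
      case base then show ?case using assms by auto
    next
      case (step y z) then show ?case using sub by (blast intro: rtrancl_on_into_rtrancl_on)
    qed
  qed
  then show ?thesis unfolding component_def reachable_def * by simp
qed

definition closed_in :: "('v, 'e) pre_digraph \<Rightarrow> 'v set \<Rightarrow> bool" where
  "closed_in D U \<longleftrightarrow> (\<forall>e \<in> arcs D. tail D e \<in> U \<longleftrightarrow> head D e \<in> U)"

lemma nbr_sym: "(x,y) \<in> nbr D \<Longrightarrow> (y,x) \<in> nbr D" by (auto simp: nbr_def insert_commute)
lemma nbrs_sym: "(x,y) \<in> (nbr D)\<^sup>* \<Longrightarrow> (y,x) \<in> (nbr D)\<^sup>*"
  by (meson nbr_sym sym_def sym_rtrancl)

lemma nbr_arc: "e \<in> arcs D \<Longrightarrow> (tail D e, head D e) \<in> nbr D" by (auto simp: nbr_def)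

lemma component_closed:
  assumes "wf_digraph D" "v \<in> verts D"
  shows "closed_in D (component D v)"
  unfolding closed_in_def component_conv[OF assms] mem_Collect_eq
  by (metis nbr_arc nbr_sym rtrancl.rtrancl_into_rtrancl)

lemma component_self: "v \<in> verts D \<Longrightarrow> v \<in> component D v"
  by (auto simp: component_def reachable_def)

lemma component_sub: "component D v \<subseteq> verts D"
  by (auto simp: component_def elim!: reachable_in_vertsE)

lemma component_least:
  assumes "wf_digraph D" "v \<in> verts D" "closed_in D U" "v \<in> U"
  shows "component D v \<subseteq> U"
proof -
  have "(v,u) \<in> (nbr D)\<^sup>* \<Longrightarrow> u \<in> U" for u
  proof (induction rule: rtrancl_induct)
    case base then show ?case by fact
  next
    case (step y z)
    then obtain e where "e \<in> arcs D" "{y, z} = {tail D e, head D e}" by (auto simp: nbr_def)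
    with step assms(3) show ?case by (auto simp: closed_in_def doubleton_eq_iff)
  qed
  then show ?thesis by (auto simp: component_conv[OF assms(1,2)])
qed

lemma deg_one_restrict:
  assumes "deg_one D" "closed_in D U" "U \<subseteq> verts D"
  shows "deg_one (D \<restriction> U)"
proof -
  let ?A = "{e \<in> arcs D. tail D e \<in> U \<and> head D e \<in> U}"
  have "inj_on (tail D) ?A" "inj_on (head D) ?A"
    using assms(1) by (auto simp: deg_one_def bij_betw_def intro: inj_on_subset)
  moreover have "tail D ` ?A = U"
  proof (intro equalityI subsetI)
    fix x assume x: "x \<in> U"
    then obtain e where "e \<in> arcs D" "tail D e = x"
      using assms by (metis (no_types, lifting) bij_betw_imp_surj_on deg_one_def imageE subsetD)
    with x show "x \<in> tail D ` ?A" using assms(2) by (auto simp: closed_in_def)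
  qed auto
  moreover have "head D ` ?A = U"
  proof (intro equalityI subsetI)
    fix x assume x: "x \<in> U"
    then obtain e where "e \<in> arcs D" "head D e = x"
      using assms by (metis (no_types, lifting) bij_betw_imp_surj_on deg_one_def imageE subsetD)
    with x show "x \<in> head D ` ?A" using assms(2) by (auto simp: closed_in_def)
  qed auto
  ultimately show ?thesis by (auto simp: deg_one_def bij_betw_def induce_subgraph_def)
qed

lemma fin_restrict:
  assumes "fin_digraph D" "U \<subseteq> verts D"
  shows "fin_digraph (D \<restriction> U)"
proof -
  interpret fin_digraph D by fact
  show ?thesis by unfold_locales (use assms finite_subset[OF assms(2)] in \<open>auto simp: induce_subgraph_def\<close>)
qed

lemma cycle_deg:
  assumes "fin_digraph C" "directed_cycle C" shows "deg_one C"
proof -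
  interpret fin_digraph C by fact
  obtain p u where p: "awalk u p u" "distinct (tl (awalk_verts u p))" "p \<noteq> []"
    "arcs C = set p" "verts C = tail C ` set p"
    using assms(2) by (auto simp: directed_cycle_def cycle_def)
  have "awalk_verts u p = u # map (head C) p" if "cas u p v" for u v p
    using that by (induction p arbitrary: u) auto
  then have d: "distinct (map (head C) p)" using p(1,2) by (fastforce simp: awalk_def)
  then have inj: "inj_on (head C) (arcs C)" using p(4) by (simp add: distinct_map)
  have c: "card (head C ` arcs C) = card (arcs C)" using inj card_image by blast
  have hs: "head C ` arcs C \<subseteq> verts C" by auto
  have "card (arcs C) \<le> card (verts C)" using c card_mono[OF finite_verts hs] by simp
  moreover have "card (verts C) \<le> card (arcs C)" using p(4,5) card_image_le[OF finite_arcs] by simp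
  ultimately have e: "card (arcs C) = card (verts C)" by simp
  have "inj_on (tail C) (arcs C)" using e p(4,5) by (intro eq_card_imp_inj_on) auto
  moreover have "head C ` arcs C = verts C" using hs c e finite_verts card_subset_eq by metis
  ultimately show ?thesis using inj p by (auto simp: deg_one_def bij_betw_def)
qed

lemma deg_cycle:
  assumes fin: "fin_digraph C" and deg: "deg_one C" and v: "v \<in> verts C"
    and conn: "component C v = verts C"
  shows "directed_cycle C"
proof -
  interpret fin_digraph C by fact
  define s where "s x = head C (the_inv_into (arcs C) (tail C) x)" for x
  have ti: "inj_on (tail C) (arcs C)" and ts: "tail C ` arcs C = verts C"
    and hi: "inj_on (head C) (arcs C)" and hs: "head C ` arcs C = verts C"
    using deg by (auto simp: deg_one_def bij_betw_def)
  have s: "s (tail C e) = head C e" if "e \<in> arcs C" for e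
    using that ti by (simp add: s_def the_inv_into_f_f)
  have sinj: "inj_on s (verts C)"
    using ti hi by (auto simp: inj_on_def ts[symmetric] s)
  let ?R = "{u. v \<rightarrow>\<^sup>*\<^bsub>C\<^esub> u}"
  have RV: "?R \<subseteq> verts C" using reachable_in_verts by auto
  have adj: "u \<rightarrow>\<^bsub>C\<^esub> s u" if "u \<in> verts C" for u
    using that by (auto simp: ts[symmetric] s arcs_ends_conv)
  have "s ` ?R \<subseteq> ?R" using RV adj by (auto intro: reachable_adj_trans)
  then have "s ` ?R = ?R" 
    by (intro endo_inj_surj) (use RV finite_subset[OF RV] sinj in \<open>auto intro: inj_on_subset\<close>)
  moreover have "v \<in> ?R" using v by auto
  ultimately obtain u where u: "v \<rightarrow>\<^sup>*\<^bsub>C\<^esub> u" "s u = v" by (metis (mono_tags, lifting) imageE mem_Collect_eq)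
  then have "v \<rightarrow>\<^sup>+\<^bsub>C\<^esub> v" using adj[of u] RV by (metis mem_Collect_eq r_into_trancl' reachable_reachable1_trans subsetD)
  then obtain q where "awalk v q v" "q \<noteq> []" using reachable1_awalk by metis
  then obtain p where cp: "cycle p" using closed_w_imp_cycle unfolding closed_w_def by blast
  then obtain x where p: "awalk x p x" "p \<noteq> []" "distinct (tl (awalk_verts x p))" by (auto simp: cycle_def)
  have pa: "set p \<subseteq> arcs C" using p by (auto simp: awalk_def)
  have th: "tail C ` set p = head C ` set p"
  proof -
    have 1: "insert a (head C ` set p) = insert b (tail C ` set p)" if "cas a p b" for a b p
      using that by (induction p arbitrary: a) (simp, fastforce)
    have 2: "b \<in> head C ` set p" if "cas a p b" "p \<noteq> []" for a b p
      using that by (induction p arbitrary: a) (auto split: if_splits, metis cas.simps(1) image_iff)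
    have 3: "a \<in> tail C ` set p" if "cas a p b" "p \<noteq> []" for a b p
      using that by (cases p) auto
    show ?thesis using 1[of x p x] 2[of x p x] 3[of x p x] p by (simp add: awalk_def insert_absorb)
  qed
  let ?U = "tail C ` set p"
  have cl: "closed_in C ?U"
    unfolding closed_in_def
  proof (intro ballI iffI)
    fix e assume e: "e \<in> arcs C"
    { assume "tail C e \<in> ?U" then have "e \<in> set p" using e pa ti by (auto dest: inj_onD)
      then show "head C e \<in> ?U" using th by auto }
    { assume "head C e \<in> ?U" then have "e \<in> set p" using e pa hi th by (auto dest: inj_onD)
      then show "tail C e \<in> ?U" by auto }
  qed
  obtain y where y: "y \<in> ?U" using p(2) by (cases p) auto
  have yV: "y \<in> verts C" using y pa by auto
  have "(v, y) \<in> (nbr C)\<^sup>*" using conn yV component_conv[OF wf_digraph v] by auto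
  then have "v \<in> component C y" using nbrs_sym component_conv[OF wf_digraph yV] by auto
  then have "v \<in> ?U" using component_least[OF wf_digraph yV cl y] by blast
  then have "verts C \<subseteq> ?U" using component_least[OF wf_digraph v cl] conn by blast
  then have VU: "verts C = ?U" using pa by auto
  have "arcs C \<subseteq> set p"
  proof
    fix e assume e: "e \<in> arcs C"
    then have "tail C e \<in> ?U" using VU by auto
    then show "e \<in> set p" using e pa ti by (auto dest: inj_onD)
  qed
  then show ?thesis using cp pa VU unfolding directed_cycle_def by blast
qed

lemma component_restrict:
  assumes "wf_digraph D" "v \<in> verts D"
  shows "component (D \<restriction> component D v) v = component D v"
proof -
  let ?C = "component D v"
  interpret wf_digraph D by fact
  have w: "wf_digraph (D \<restriction> ?C)" by unfold_locales (auto simp: induce_subgraph_def)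
  have vc: "v \<in> ?C" using assms component_self by metis
  have cl: "closed_in D ?C" using component_closed[OF assms] .
  have "closed_in D (component (D \<restriction> ?C) v)"
    using component_closed[OF w, of v] vc cl component_sub[of "D \<restriction> ?C" v]
    by (auto simp: closed_in_def induce_subgraph_def)
  then have "?C \<subseteq> component (D \<restriction> ?C) v"
    using component_least[OF assms] component_self[of v "D \<restriction> ?C"] vc by auto
  then show ?thesis using component_sub[of "D \<restriction> ?C" v] by auto
qed

lemma boundary_cycles_conv: "boundary_cycles D \<longleftrightarrow> fin_digraph D \<and> deg_one D"
proof (cases "fin_digraph D")
  case True
  then interpret fin_digraph D .
  show ?thesis
  proof
    assume "fin_digraph D \<and> deg_one D"
    then have d: "deg_one D" by simp
    have "directed_cycle (D \<restriction> component D v)" if v: "v \<in> verts D" for v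
      by (rule deg_cycle[OF fin_restrict[OF True component_sub]
           deg_one_restrict[OF d component_closed[OF wf_digraph v] component_sub], of v])
         (use component_self[OF v] component_restrict[OF wf_digraph v] in auto)
    then show "boundary_cycles D" using True by (auto simp: boundary_cycles_def components_def)
  next
    assume b: "boundary_cycles D"
    have d: "deg_one (D \<restriction> component D v)" if "v \<in> verts D" for v
      using b that cycle_deg[OF fin_restrict[OF True component_sub]]
      by (auto simp: boundary_cycles_def components_def)
    have loc: "\<exists>!e. e \<in> arcs D \<and> tail D e = v" "\<exists>!e. e \<in> arcs D \<and> head D e = v" if v: "v \<in> verts D" for v
    proof -
      let ?C = "component D v"
      have cl: "closed_in D ?C" using component_closed[OF wf_digraph v] .
      have vc: "v \<in> ?C" using component_self[OF v] .
      have t: "bij_betw (tail D) {e \<in> arcs D. tail D e \<in> ?C \<and> head D e \<in> ?C} ?C"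
       and h: "bij_betw (head D) {e \<in> arcs D. tail D e \<in> ?C \<and> head D e \<in> ?C} ?C"
        using d[OF v] by (auto simp: deg_one_def induce_subgraph_def)
      show "\<exists>!e. e \<in> arcs D \<and> tail D e = v"
        using t cl vc unfolding bij_betw_def inj_on_def closed_in_def by (smt (verit, best) image_iff mem_Collect_eq)
      show "\<exists>!e. e \<in> arcs D \<and> head D e = v"
        using h cl vc unfolding bij_betw_def inj_on_def closed_in_def by (smt (verit, best) image_iff mem_Collect_eq)
    qed
    have "inj_on (tail D) (arcs D)" "inj_on (head D) (arcs D)"
      using loc by (metis (no_types, lifting) inj_onI tail_in_verts, metis (no_types, lifting) inj_onI head_in_verts)
    moreover have "tail D ` arcs D = verts D" "head D ` arcs D = verts D"
      using loc by (auto simp: image_iff) (metis+)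
    ultimately show "fin_digraph D \<and> deg_one D" using True by (auto simp: deg_one_def bij_betw_def)
  qed
qed (auto simp: boundary_cycles_def)

lemma deg_oneD:
  assumes "deg_one D"
  shows "e \<in> arcs D \<Longrightarrow> e' \<in> arcs D \<Longrightarrow> tail D e = tail D e' \<Longrightarrow> e = e'"
    "e \<in> arcs D \<Longrightarrow> e' \<in> arcs D \<Longrightarrow> head D e = head D e' \<Longrightarrow> e = e'"
    "x \<in> verts D \<Longrightarrow> \<exists>e \<in> arcs D. tail D e = x" "x \<in> verts D \<Longrightarrow> \<exists>e \<in> arcs D. head D e = x"
  using assms unfolding deg_one_def bij_betw_def inj_on_def by (blast, blast, (metis imageE)+)

context
  fixes D :: "('v, 'e) pre_digraph" and v w v1 v2 w1 w2 :: 'v and f f' :: 'e and S E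
  assumes fin: "fin_digraph D" and deg: "deg_one D"
    and fr: "fresh_split D v w v1 v2 w1 w2" and f: "f \<notin> arcs D" "f' \<notin> arcs D" "f \<noteq> f'"
  defines "S \<equiv> split_points D v w v1 v2 w1 w2"
    and "E \<equiv> add_edge (add_edge S f w2 v1) f' v2 w1"
begin

interpretation fin_digraph D by (rule fin)

lemma cut_S_tail: "tail S e = (if tail D e = v then v1 else if tail D e = w then w1 else tail D e)" if "e \<in> arcs D" for e
  using fr that by (auto simp: S_def split_points_def split_vertex_def add_points_def Let_def fresh_split_def)

lemma cut_S_head: "head S e = (if head D e = w then w2 else if head D e = v then v2 else head D e)" if "e \<in> arcs D" for e
  using fr that by (auto simp: S_def split_points_def split_vertex_def add_points_def Let_def fresh_split_def)

lemma cut_S_verts: "verts S = (verts D - {v, w}) \<union> {v1, v2, w1, w2}" and cut_S_arcs: "arcs S = arcs D"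
  using fr by (auto simp: S_def split_points_def split_vertex_def add_points_def Let_def fresh_split_def)

lemma cut_E_verts: "verts E = (verts D - {v, w}) \<union> {v1, v2, w1, w2}" and cut_E_arcs: "arcs E = insert f (insert f' (arcs D))"
  using cut_S_verts cut_S_arcs by (auto simp: E_def add_edge_def)

lemma cut_E_tail: "tail E e = (if e = f then w2 else if e = f' then v2 else tail S e)"
  and cut_E_head: "head E e = (if e = f then v1 else if e = f' then w1 else head S e)"
  using f by (auto simp: E_def add_edge_def)

lemma cut_S_wf: "wf_digraph S"
  by unfold_locales (auto simp: cut_S_verts cut_S_arcs cut_S_tail cut_S_head)

lemma cut_E_fin: "fin_digraph E"
proof -
  have "verts E = verts S" by (simp add: cut_E_verts cut_S_verts)
  moreover have "tail S e \<in> verts S" "head S e \<in> verts S" if "e \<in> arcs D" for e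
    using that cut_S_wf cut_S_arcs wf_digraph.tail_in_verts wf_digraph.head_in_verts by metis+
  moreover have "{v1, v2, w1, w2} \<subseteq> verts S" "finite (verts S)" by (auto simp: cut_S_verts)
  ultimately show ?thesis
    by unfold_locales (auto simp: cut_E_arcs cut_E_tail cut_E_head)
qed

lemma cut_fr_verts: "v1 \<notin> verts D" "v2 \<notin> verts D" "w1 \<notin> verts D" "w2 \<notin> verts D"
  using fr by (auto simp: fresh_split_def)

lemma bij_add2:
  assumes "bij_betw h A B" "f \<notin> A" "f' \<notin> A" "f \<noteq> f'" "a \<notin> B" "b \<notin> B" "a \<noteq> b"
    "k f = a" "k f' = b" "\<And>e. e \<in> A \<Longrightarrow> k e = h e"
  shows "bij_betw k (insert f (insert f' A)) (insert a (insert b B))"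
proof -
  have "bij_betw k A B" using assms(1,10) bij_betw_cong by metis
  then have k: "inj_on k A" "k ` A = B" by (auto simp: bij_betw_def)
  have i: "k ` insert f (insert f' A) = insert a (insert b B)" using k(2) assms(8,9) by simp
  moreover have "inj_on k (insert f (insert f' A))"
  proof -
    have "k f' \<notin> k ` A" "k f \<notin> k ` insert f' A" using k(2) assms(5-9) by auto
    then show ?thesis using k(1) assms(2-4) by simp
  qed
  ultimately show ?thesis unfolding bij_betw_def by blast
qed

lemma cut_E_deg: "deg_one E"
proof -
  let ?r = "\<lambda>x. if x = v then v1 else if x = w then w1 else x"
  let ?q = "\<lambda>x. if x = w then w2 else if x = v then v2 else x"
  have td: "bij_betw (tail D) (arcs D) (verts D)" and hd: "bij_betw (head D) (arcs D) (verts D)"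
    using deg by (auto simp: deg_one_def)
  have "inj_on ?r (verts D)" "inj_on ?q (verts D)"
    using fr cut_fr_verts by (auto simp: inj_on_def fresh_split_def)
  then have "bij_betw ?r (verts D) (?r ` verts D)" "bij_betw ?q (verts D) (?q ` verts D)"
    by (simp_all only: inj_on_imp_bij_betw)
  then have t: "bij_betw (?r \<circ> tail D) (arcs D) (?r ` verts D)" and h: "bij_betw (?q \<circ> head D) (arcs D) (?q ` verts D)"
    using td hd bij_betw_trans by blast+
  have im: "w2 \<notin> ?r ` verts D" "v2 \<notin> ?r ` verts D" "v1 \<notin> ?q ` verts D" "w1 \<notin> ?q ` verts D" "w2 \<noteq> v2" "v1 \<noteq> w1"
    using fr cut_fr_verts by (auto simp: fresh_split_def split: if_splits)
  have r: "verts E = insert w2 (insert v2 (?r ` verts D))"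
    using fr cut_fr_verts unfolding cut_E_verts
    by (cases "v = w"; cases "v \<in> verts D"; cases "w \<in> verts D") (auto simp: fresh_split_def image_iff)
  have q: "verts E = insert v1 (insert w1 (?q ` verts D))"
    using fr cut_fr_verts unfolding cut_E_verts
    by (cases "v = w"; cases "v \<in> verts D"; cases "w \<in> verts D") (auto simp: fresh_split_def image_iff)
  have nf: "e \<in> arcs D \<Longrightarrow> e \<noteq> f \<and> e \<noteq> f'" for e using f by auto
  have "bij_betw (tail E) (arcs E) (verts E)" unfolding r cut_E_arcs
    by (rule bij_add2[OF t]) (use f im nf in \<open>simp_all add: cut_E_tail cut_S_tail del: image_iff\<close>)
  moreover have "bij_betw (head E) (arcs E) (verts E)" unfolding q cut_E_arcs
    by (rule bij_add2[OF h]) (use f im nf in \<open>simp_all add: cut_E_head cut_S_head\<close>)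
  ultimately show ?thesis by (simp add: deg_one_def)
qed

lemma bij_pre: "bij_betw k A B \<Longrightarrow> U \<subseteq> B \<Longrightarrow> bij_betw k {e \<in> A. k e \<in> U} U"
  unfolding bij_betw_def by (auto intro: inj_on_subset)

lemma cut_counting:
  assumes U: "U \<subseteq> verts S" "closed_in S U"
  shows "of_bool (w2 \<in> U) + of_bool (v2 \<in> U) = (of_bool (v1 \<in> U) + of_bool (w1 \<in> U) :: nat)"
proof -
  let ?A = "{e \<in> arcs D. tail S e \<in> U}"
  have UE: "U \<subseteq> verts E" using U by (simp add: cut_E_verts cut_S_verts)
  have fE: "finite (arcs E)" by (simp add: cut_E_arcs)
  have A: "?A = {e \<in> arcs D. head S e \<in> U}" using U(2) by (auto simp: closed_in_def cut_S_arcs)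
  have split: "card ({e. e = f \<and> a} \<union> {e. e = f' \<and> b} \<union> ?A) = of_bool a + of_bool b + card ?A" for a b
  proof -
    have [simp]: "f \<notin> ?A" "f' \<notin> ?A" "finite ?A" using f by auto
    show ?thesis using f(3) by (cases a; cases b) (simp_all del: mem_Collect_eq add: Collect_conv_if)
  qed
  have t1: "{e \<in> arcs E. tail E e \<in> U} = {e. e = f \<and> w2 \<in> U} \<union> {e. e = f' \<and> v2 \<in> U} \<union> ?A"
    using f by (auto simp: cut_E_arcs cut_E_tail)
  have t2: "card {e \<in> arcs E. tail E e \<in> U} = card U"
    using cut_E_deg UE unfolding deg_one_def
    by (intro bij_betw_same_card[OF bij_pre]) auto
  have t: "card U = of_bool (w2 \<in> U) + of_bool (v2 \<in> U) + card ?A"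
    by (rule trans[OF t2[symmetric, unfolded t1] split])
  have h1: "{e \<in> arcs E. head E e \<in> U} = {e. e = f \<and> v1 \<in> U} \<union> {e. e = f' \<and> w1 \<in> U} \<union> ?A"
    unfolding A using f by (auto simp: cut_E_arcs cut_E_head)
  have h2: "card {e \<in> arcs E. head E e \<in> U} = card U"
    using cut_E_deg UE unfolding deg_one_def
    by (intro bij_betw_same_card[OF bij_pre]) auto
  have "card U = of_bool (v1 \<in> U) + of_bool (w1 \<in> U) + card ?A"
    by (rule trans[OF h2[symmetric, unfolded h1] split])
  with t show ?thesis by linarith
qed

lemma add_points_simps: "verts (add_points D v w) = verts D \<union> {v, w}" "arcs (add_points D v w) = arcs D"
  "tail (add_points D v w) = tail D" "head (add_points D v w) = head D" by (auto simp: add_points_def)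

lemma add_points_wf: "wf_digraph (add_points D v w)"
  by unfold_locales (auto simp: add_points_simps)

lemma cut_no_sep:
  assumes "same_component D v w" "v \<noteq> w" "U \<subseteq> verts S" "closed_in S U" "v1 \<in> U" "v2 \<in> U" "w1 \<notin> U" "w2 \<notin> U"
  shows False
proof -
  let ?U = "U - {v1, v2} \<union> {v}"
  have fresh: "tail D e \<notin> {v1, v2, w1, w2}" "head D e \<notin> {v1, v2, w1, w2}" if "e \<in> arcs D" for e
    using fr that tail_in_verts[OF that] head_in_verts[OF that] by (auto simp: fresh_split_def)
  have vwU: "v \<notin> U" "w \<notin> U" using assms(3) fr by (auto simp: cut_S_verts fresh_split_def)
  have "closed_in (add_points D v w) ?U"
    unfolding closed_in_def add_points_simps
  proof
    fix e assume e: "e \<in> arcs D"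
    then have c: "tail S e \<in> U \<longleftrightarrow> head S e \<in> U" using assms(4) by (auto simp: closed_in_def cut_S_arcs)
    have "tail S e \<in> U \<longleftrightarrow> tail D e \<in> ?U"
      using fresh[OF e] assms vwU by (auto simp: cut_S_tail[OF e])
    moreover have "head S e \<in> U \<longleftrightarrow> head D e \<in> ?U"
      using fresh[OF e] assms vwU by (auto simp: cut_S_head[OF e])
    ultimately show "tail D e \<in> ?U \<longleftrightarrow> head D e \<in> ?U" using c by simp
  qed
  then have "component (add_points D v w) v \<subseteq> ?U"
    by (intro component_least[OF add_points_wf]) (auto simp: add_points_simps)
  moreover have "w \<in> component (add_points D v w) v"
    using assms(1) component_self[of w "add_points D v w"] by (simp add: same_component_def add_points_simps)
  ultimately show False using vwU assms(2) by auto
qed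

lemma cut_v12_in: "v1 \<in> verts S" "v2 \<in> verts S" by (auto simp: cut_S_verts)

lemma cut_P_closed:
  assumes "same_component D v w"
  shows "closed_in E (component S v1)"
proof -
  let ?P = "component S v1"
  have cl: "closed_in S ?P" by (rule component_closed[OF cut_S_wf cut_v12_in(1)])
  have v1: "v1 \<in> ?P" using component_self[OF cut_v12_in(1)] .
  note c = cut_counting[OF component_sub cl]
  have "w2 \<in> ?P"
  proof (rule ccontr)
    assume n: "w2 \<notin> ?P"
    then have a: "v2 \<in> ?P" "w1 \<notin> ?P" using c v1 by (auto simp: of_bool_def split: if_splits)
    then have "v \<noteq> w" using fr by (auto simp: fresh_split_def)
    then show False using cut_no_sep[OF assms _ component_sub cl v1 a(1) a(2) n] by simp
  qed
  then show ?thesis using c v1 cl f unfolding closed_in_def cut_E_arcs cut_E_tail cut_E_head cut_S_arcs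
    by (auto simp: of_bool_def split: if_splits)
qed

lemma cut_P'_closed:
  assumes "same_component D v w"
  shows "closed_in E (component S v2)"
proof -
  let ?P = "component S v2"
  have cl: "closed_in S ?P" by (rule component_closed[OF cut_S_wf cut_v12_in(2)])
  have v2: "v2 \<in> ?P" using component_self[OF cut_v12_in(2)] .
  note c = cut_counting[OF component_sub cl]
  have "w1 \<in> ?P"
  proof (rule ccontr)
    assume n: "w1 \<notin> ?P"
    then have a: "v1 \<in> ?P" "w2 \<notin> ?P" using c v2 by (auto simp: of_bool_def split: if_splits)
    then have "v \<noteq> w" using n v2 fr by (auto simp: fresh_split_def)
    then show False using cut_no_sep[OF assms _ component_sub cl a(1) v2 n a(2)] by simp
  qed
  then show ?thesis using c v2 cl f unfolding closed_in_def cut_E_arcs cut_E_tail cut_E_head cut_S_arcs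
    by (auto simp: of_bool_def split: if_splits)
qed

lemma cut_K_closed:
  assumes "same_component D v w" "K \<subseteq> other_components D v w"
  shows "closed_in E (\<Union>K)" "\<Union>K \<subseteq> verts E"
proof -
  let ?D = "add_points D v w"
  have wf: "wf_digraph ?D" by (rule add_points_wf)
  have key: "closed_in ?D C \<and> C \<subseteq> verts ?D \<and> v \<notin> C \<and> w \<notin> C" if CK: "C \<in> K" for C
  proof -
    obtain x where x: "x \<in> verts ?D" "C = component ?D x" "C \<noteq> component ?D v"
      using assms(2) CK unfolding other_components_def components_def by blast
    have eq: "component ?D x = component ?D y" if y: "y \<in> component ?D x" for y
    proof -
      have yV: "y \<in> verts ?D" by (rule subsetD[OF component_sub y])
      have xy: "(x, y) \<in> (nbr ?D)\<^sup>*" using y unfolding component_conv[OF wf x(1)] by (rule CollectD)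
      with nbrs_sym have "(y, x) \<in> (nbr ?D)\<^sup>*" by metis
      with xy show ?thesis unfolding component_conv[OF wf x(1)] component_conv[OF wf yV]
        by (intro Collect_cong) (metis rtrancl_trans)
    qed
    have "v \<notin> C" "w \<notin> C"
      using eq[of v] eq[of w] x(2,3) assms(1) unfolding same_component_def by metis+
    then show ?thesis using component_closed[OF wf x(1)] component_sub x(2) by metis
  qed
  have fresh: "{v1, v2, w1, w2} \<inter> \<Union>K = {}" 
    using key fr by (fastforce simp: fresh_split_def add_points_simps)
  show "\<Union>K \<subseteq> verts E" using key by (fastforce simp: add_points_simps cut_E_verts)
  show "closed_in E (\<Union>K)" unfolding closed_in_def
  proof
    fix e assume e: "e \<in> arcs E"
    show "(tail E e \<in> \<Union>K) = (head E e \<in> \<Union>K)"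
    proof (cases "e \<in> {f, f'}")
      case True then show ?thesis using fresh f by (auto simp: cut_E_tail cut_E_head)
    next
      case False
      then have eD: "e \<in> arcs D" using e by (auto simp: cut_E_arcs)
      have "tail D e \<in> C \<longleftrightarrow> head D e \<in> C" if "C \<in> K" for C
        using key[OF that] eD by (auto simp: closed_in_def add_points_simps)
      then have "tail D e \<in> \<Union>K \<longleftrightarrow> head D e \<in> \<Union>K" by blast
      moreover have "tail E e \<in> \<Union>K \<longleftrightarrow> tail D e \<in> \<Union>K" "head E e \<in> \<Union>K \<longleftrightarrow> head D e \<in> \<Union>K"
        using False fresh key by (auto simp: cut_E_tail cut_E_head cut_S_tail[OF eD] cut_S_head[OF eD])
      ultimately show ?thesis by simp
    qed
  qed
qed

lemma cut_P_sub: "component S v1 \<subseteq> verts E" "component S v2 \<subseteq> verts E"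
  using component_sub by (fastforce simp: cut_E_verts cut_S_verts)+

lemma cut_E_proper:
  assumes "proper D \<chi>" "l \<notin> \<chi> ` arcs D"
  shows "proper E (\<chi>(f := l, f' := l))"
  unfolding proper_def
proof
  fix l'
  show "card {e \<in> arcs E. (\<chi>(f := l, f' := l)) e = l'} \<le> 2"
  proof (cases "l' = l")
    case True
    then have "{e \<in> arcs E. (\<chi>(f := l, f' := l)) e = l'} = {f, f'}" using assms(2) by (auto simp: cut_E_arcs)
    then show ?thesis using f by simp
  next
    case False
    then have "{e \<in> arcs E. (\<chi>(f := l, f' := l)) e = l'} = {e \<in> arcs D. \<chi> e = l'}" using f by (auto simp: cut_E_arcs)
    then show ?thesis using assms(1) by (simp add: proper_def)
  qed
qed

end

lemma proper_restrict: "finite (arcs E) \<Longrightarrow> proper E \<chi> \<Longrightarrow> proper (E \<restriction> U) \<chi>"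
proof -
  assume f: "finite (arcs E)" and p: "proper E \<chi>"
  have "card {e \<in> arcs (E \<restriction> U). \<chi> e = l} \<le> card {e \<in> arcs E. \<chi> e = l}" for l
    using f by (intro card_mono) (auto simp: induce_subgraph_def)
  then show ?thesis using p unfolding proper_def by (meson order_trans)
qed

lemma closed_un: "closed_in E U \<Longrightarrow> closed_in E U' \<Longrightarrow> closed_in E (U \<union> U')"
  by (auto simp: closed_in_def)

theorem cutter_turn_game_state:
  fixes s :: "('a, 'b, 'c) config"
  assumes "cutter_turn s m K h s'" "game_state s"
  shows "game_state s'"
proof -
  have base: "boundary_cycles E \<and> proper E \<chi>' \<and> (same_component D v w \<longrightarrow>
      closed_in E P \<and> closed_in E P' \<and> P \<subseteq> verts E \<and> P' \<subseteq> verts E \<and>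
      (\<forall>K \<subseteq> other_components D v w. closed_in E (\<Union>K) \<and> \<Union>K \<subseteq> verts E))"
    if c: "cut D \<chi> v w P P' E \<chi>'" and s: "game_state (D, \<chi>, g)" for D :: "('a, 'b) pre_digraph" and \<chi> :: "'b \<Rightarrow> 'c" and v w P P' E \<chi>' g
  proof -
    have D: "fin_digraph D" "deg_one D" "proper D \<chi>" using s by (auto simp: game_state_def boundary_cycles_conv)
    obtain v1 v2 w1 w2 f f' l where
      x: "fresh_split D v w v1 v2 w1 w2" "f \<notin> arcs D" "f' \<notin> arcs D" "f \<noteq> f'" and l: "l \<notin> \<chi> ` arcs D" and
      y: "P = component (split_points D v w v1 v2 w1 w2) v1" "P' = component (split_points D v w v1 v2 w1 w2) v2"
      "E = add_edge (add_edge (split_points D v w v1 v2 w1 w2) f w2 v1) f' v2 w1" "\<chi>' = \<chi>(f := l, f' := l)"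
      using c by (auto simp: cut_def Let_def)
    show ?thesis unfolding y boundary_cycles_conv
      using cut_E_fin[OF D(1,2) x] cut_E_deg[OF D(1,2) x] cut_E_proper[OF D(1,2) x D(3) l]
        cut_P_closed[OF D(1,2) x] cut_P'_closed[OF D(1,2) x] cut_P_sub[OF D(1,2) x] cut_K_closed[OF D(1,2) x]
      by blast
  qed
  have res: "game_state (E \<restriction> U, \<chi>', g')" if "boundary_cycles E" "proper E \<chi>'" "closed_in E U" "U \<subseteq> verts E" 
    for E :: "('a, 'b) pre_digraph" and \<chi>' :: "'b \<Rightarrow> 'c" and U g'
    using that fin_restrict[of E U] deg_one_restrict[of E U] proper_restrict[of E \<chi>' U] fin_digraph.finite_arcs[of E]
    by (simp add: game_state_def boundary_cycles_conv)
  show ?thesis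
    using assms
  proof (induction rule: cutter_turn.induct)
    case move_a
    with base[OF move_a.hyps(1) move_a.prems] show ?case by (intro res closed_un) auto
  next
    case move_b
    with base[OF move_b.hyps(1) move_b.prems] show ?case by (intro res closed_un) auto
  next
    case move_c
    with base[OF move_c.hyps(1) move_c.prems] show ?case by (intro res closed_un) auto
  next
    case move_d
    with base[OF move_d.hyps(1) move_d.prems] show ?case by (simp add: game_state_def)
  qed
qed

lemma cut_exists:
  fixes D :: "('v::infinite, 'e::infinite) pre_digraph" and \<chi> :: "'e \<Rightarrow> 'l::infinite"
  assumes "fin_digraph D"
  shows "\<exists>P P' E \<chi>'. cut D \<chi> v w P P' E \<chi>'"
proof -
  interpret fin_digraph D by fact
  let ?X = "verts D \<union> {v, w}"
  have fX: "finite ?X" by simp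
  obtain a where a: "a \<notin> ?X" using arb_element[OF fX] by blast
  obtain b where b: "b \<notin> ?X \<union> {a}" using arb_element[of "?X \<union> {a}"] by auto
  obtain c where c: "c \<notin> ?X \<union> {a, b}" using arb_element[of "?X \<union> {a, b}"] by auto
  obtain d where d: "d \<notin> ?X \<union> {a, b, c}" using arb_element[of "?X \<union> {a, b, c}"] by auto
  have "\<exists>v1 v2 w1 w2. fresh_split D v w v1 v2 w1 w2"
  proof (cases "v = w")
    case True
    then show ?thesis using a b c
      by (intro exI[of _ a] exI[of _ b] exI[of _ b] exI[of _ "if v \<in> verts D then c else a"]) (auto simp: fresh_split_def)
  next
    case False
    then show ?thesis using a b c d
      by (intro exI[of _ a] exI[of _ "if v \<in> verts D then c else a"] exI[of _ b] exI[of _ "if w \<in> verts D then d else b"]) (auto simp: fresh_split_def)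
  qed
  moreover obtain f where "f \<notin> arcs D" using arb_element[OF finite_arcs] by blast
  moreover then obtain f' where "f' \<notin> insert f (arcs D)" using arb_element[of "insert f (arcs D)"] by auto
  moreover obtain l where "l \<notin> \<chi> ` arcs D" using arb_element[of "\<chi> ` arcs D"] by auto
  ultimately show ?thesis unfolding cut_def Let_def by (metis insert_iff)
qed

theorem unrestricted_cutter_can_move:
  fixes s :: "('v::infinite, 'e::infinite, 'l::infinite) config"
  assumes "game_state (last H)"
  shows "\<exists>s :: ('v::infinite, 'e::infinite, 'l::infinite) config. unrestricted_cutter H m s"
proof -
  obtain D \<chi> g where l: "last H = (D, \<chi>, g)" by (cases "last H") auto
  obtain v w where m: "m = (v, w)" by (cases m)
  have "fin_digraph D" using assms l by (auto simp: game_state_def boundary_cycles_def)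
  from cut_exists[OF this] obtain P P' E \<chi>' where c: "cut D \<chi> v w P P' E \<chi>'" by blast
  show ?thesis
  proof (cases "same_component D v w")
    case True then show ?thesis unfolding unrestricted_cutter_def l m
      using move_b[OF c True, of "{}" 0 g] by (metis empty_subsetI zero_le)
  next
    case False then show ?thesis unfolding unrestricted_cutter_def l m using move_d[OF c False] by blast
  qed
qed

lemma dummies_fresh:
  fixes D :: "('v::infinite, 'e) pre_digraph"
  assumes "finite (verts D)" "dummies D = (x, y)"
  shows "x \<noteq> y" "x \<notin> verts D" "y \<notin> verts D"
proof -
  obtain a where a: "a \<notin> verts D" using arb_element[OF assms(1)] by blast
  obtain b where b: "b \<notin> insert a (verts D)" using arb_element[of "insert a (verts D)"] assms(1) by auto
  have "case dummies D of (x, y) \<Rightarrow> x \<noteq> y \<and> x \<notin> verts D \<and> y \<notin> verts D"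
    unfolding dummies_def by (rule someI[of _ "(a, b)"]) (use a b in auto)
  then show "x \<noteq> y" "x \<notin> verts D" "y \<notin> verts D" using assms(2) by auto
qed

lemma play_game_state:
  assumes "play R \<sigma> g\<^sub>0 H" "R = unrestricted_cutter \<or> R = restricted_cutter"
  shows "H \<noteq> [] \<and> (\<forall>s \<in> set H. game_state s)"
  using assms
proof (induction rule: play.induct)
  case play_start
  have "fin_digraph (\<lparr>verts = {}, arcs = {}, tail = \<lambda>_. undefined, head = \<lambda>_. undefined\<rparr>)"
    by unfold_locales auto
  then show ?case by (auto simp: initial_state_def game_state_def boundary_cycles_def components_def proper_def)
next
  case (play_turn H s)
  then have H: "H \<noteq> []" "\<forall>s \<in> set H. game_state s" by auto
  then have l: "game_state (last H)" by auto
  obtain K h where "cutter_turn (last H) (\<sigma> H) K h s"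
    using play_turn by (cases "last H") (auto simp: unrestricted_cutter_def restricted_cutter_def)
  then show ?case using H cutter_turn_game_state[OF _ l] by auto
qed

end

theory Submission
  imports Defs
begin

text \<open>
  A state is determined, as far as the game is concerned, by the cyclic successor function on its
  arcs. A state is a minor of another one if its arcs embed into those of the other such
  that the successor function is the induced first-return map. Minors contain the reductions up to
  equivalence, they form a transitive relation, and passing to a minor does not increase the value.

  Marker keeps the invariant that the actual state is a minor of the last state of some play of the
  restricted game in which Marker follows the given strategy. Marker translates the choice made in
  that state. Any answer of Cutter is matched by a full move in the restricted game, where the old
  state embeds into the new one again. If that full move is forbidden because it leads to a
  reduction of an earlier state, then Marker forgets the restricted play from that
  earlier state on, and the invariant holds by transitivity. No bound on the length of the
  plays is needed.

  That the two cuts match is seen by splitting a cut into steps on successor functions, namely the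
  insertion of two arcs and the exchange of their successors, which each preserve
  embeddings.
\<close>

section \<open>Embeddings of successor functions\<close>

text \<open>Arcs rather than vertices carry the comparison because a cut replaces vertices and a
  contraction merges them, whereas arcs keep their names and carry the labels. The obstacle is that
  Cutter's options depend on whether Marker's two vertices share a component, so the two games must
  agree on this although the larger state has more arcs. The criterion comes from permutations:
  exchanging the successors of the two new arcs composes a permutation with a transposition, which
  splits a common cycle and joins two distinct ones. Hence the vertices shared a component exactly
  if the new arcs end up on different cycles, and embeddings both preserve and reflect lying on one
  cycle. The same fact matches moves (b) and (c): each discards the cycle of one of the new arcs,
  and the matching move discards the cycle of its image. Dropped components and a lowered counter
  need no counterpart, since they only make the actual state smaller relative to the one it embeds
  into.\<close>

definition steps :: "('e \<Rightarrow> 'e) \<Rightarrow> 'e set \<Rightarrow> 'e rel" where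
  "steps n B = {(x, n x) | x. x \<in> B}"

lemma steps_iff: "(x, y) \<in> steps n B \<longleftrightarrow> x \<in> B \<and> y = n x"
  by (auto simp: steps_def)

lemma steps_mono: "B \<subseteq> C \<Longrightarrow> (x, y) \<in> (steps n B)\<^sup>* \<Longrightarrow> (x, y) \<in> (steps n C)\<^sup>*"
  by (rule rtrancl_mono[THEN subsetD]) (auto simp: steps_iff)

lemma steps_cong: "(\<And>x. x \<in> B \<Longrightarrow> n x = n' x) \<Longrightarrow> steps n B = steps n' B"
  by (auto simp: steps_iff)

lemma steps_terminal:
  assumes "(x, y) \<in> (steps n B)\<^sup>*" "x \<notin> B"
  shows "y = x"
  using assms by (auto simp: steps_iff elim: converse_rtranclE)

lemma steps_first:
  assumes "(x, y) \<in> (steps n B)\<^sup>*" "x \<noteq> y"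
  shows "(n x, y) \<in> (steps n B)\<^sup>*"
  using assms by (auto simp: steps_iff elim: converse_rtranclE)

lemma steps_extend:
  assumes "(x, y) \<in> (steps n B)\<^sup>*" "y \<in> B"
  shows "(x, n y) \<in> (steps n B)\<^sup>*"
  using assms by (meson rtrancl_into_rtrancl steps_iff)

lemma steps_end_unique:
  assumes "(x, y) \<in> (steps n B)\<^sup>*" "(x, z) \<in> (steps n B)\<^sup>*" "y \<notin> B" "z \<notin> B"
  shows "y = z"
  using assms
proof (induction rule: converse_rtrancl_induct)
  case base
  then show ?case using steps_terminal by metis
next
  case (step x x')
  then have "x \<noteq> z" "x' = n x" by (auto simp: steps_iff)
  then show ?case using step steps_first by metis
qed

text \<open>A cycle through \<open>x\<close> would put every later point of the walk on a cycle as
  well, including \<open>y\<close>, from which no step leaves. The induction pushes the cycle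
  forward one step at a time.\<close>

lemma steps_acyclic:
  assumes "(x, y) \<in> (steps n B)\<^sup>*" "y \<notin> B"
  shows "(x, x) \<notin> (steps n B)\<^sup>+"
  using assms
proof (induction rule: converse_rtrancl_induct)
  case base
  then show ?case by (auto simp: steps_iff dest: tranclD)
next
  case (step x x')
  show ?case
  proof
    assume "(x, x) \<in> (steps n B)\<^sup>+"
    then obtain z where "(x, z) \<in> steps n B" "(z, x) \<in> (steps n B)\<^sup>*" by (meson tranclD)
    then have "(x', x) \<in> (steps n B)\<^sup>*" using step(1) by (auto simp: steps_iff)
    then have "(x', x') \<in> (steps n B)\<^sup>+" using step(1) by simp
    then show False using step by blast
  qed
qed

lemma steps_invariant:
  assumes "(x, y) \<in> (steps n B)\<^sup>*" "x \<in> U" "\<And>z. z \<in> B \<Longrightarrow> z \<in> U \<Longrightarrow> n z \<in> U"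
  shows "y \<in> U"
  using assms by (induction rule: rtrancl_induct) (auto simp: steps_iff)

lemma orbit_image:
  assumes "finite A" "bij_betw n A A" "x \<in> A"
  shows "(steps n A)\<^sup>* `` {x} \<subseteq> A" "n ` ((steps n A)\<^sup>* `` {x}) = (steps n A)\<^sup>* `` {x}"
proof -
  let ?O = "(steps n A)\<^sup>* `` {x}"
  show sub: "?O \<subseteq> A"
    using assms(2,3) by (auto elim!: steps_invariant dest: bij_betwE)
  show "n ` ?O = ?O"
  proof (rule endo_inj_surj)
    show "finite ?O" using sub assms(1) finite_subset by blast
    show "n ` ?O \<subseteq> ?O" using sub by (auto intro: steps_extend)
    show "inj_on n ?O" using sub assms(2) by (auto simp: bij_betw_def intro: inj_on_subset)
  qed
qed

text \<open>Forward orbits of a finite permutation are cycles. This lets directed walks stand for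
  undirected components later.\<close>

lemma orbit_sym:
  assumes "finite A" "bij_betw n A A" "(x, y) \<in> (steps n A)\<^sup>*"
  shows "(y, x) \<in> (steps n A)\<^sup>*"
proof (cases "x \<in> A")
  case True
  have "(y, x) \<in> (steps n A)\<^sup>*" using assms(3)
  proof (induction rule: rtrancl_induct)
    case (step y z)
    then have y: "y \<in> A" "z = n y" by (auto simp: steps_iff)
    then have z: "z \<in> A" using assms(2) by (auto dest: bij_betwE)
    have "(y, z) \<in> (steps n A)\<^sup>*" using step(2) by auto
    have "z \<in> (steps n A)\<^sup>* `` {z}" by auto
    then obtain u where u: "(z, u) \<in> (steps n A)\<^sup>*" "z = n u"
      using orbit_image(2)[OF assms(1,2) z] by (metis Image_singleton_iff imageE)
    have "u \<in> A" using orbit_image(1)[OF assms(1,2) z] u(1) by auto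
    then have "u = y" using u(2) y assms(2) by (auto simp: bij_betw_def dest: inj_onD)
    then show ?case using u step by auto
  qed auto
  then show ?thesis .
next
  case False
  then show ?thesis using steps_terminal[OF assms(3)] by simp
qed

section \<open>Embeddings as first-return maps\<close>

text \<open>Starting the walk at \<open>n' (\<iota> e)\<close> makes \<open>\<iota> (n e)\<close>
  the first image arc strictly after \<open>\<iota> e\<close>; for \<open>n e = e\<close> the walk
  goes once around the cycle.\<close>

definition embeds ::
  "'e set \<Rightarrow> ('e \<Rightarrow> 'e) \<Rightarrow> 'f set \<Rightarrow> ('f \<Rightarrow> 'f) \<Rightarrow> ('e \<Rightarrow> 'f) \<Rightarrow> bool" where
  "embeds A n A' n' \<iota> \<longleftrightarrow> inj_on \<iota> A \<and> \<iota> ` A \<subseteq> A' \<and>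
     (\<forall>e \<in> A. (n' (\<iota> e), \<iota> (n e)) \<in> (steps n' (A' - \<iota> ` A))\<^sup>*)"

lemma embeds_cong:
  assumes "\<And>e. e \<in> A \<Longrightarrow> n e = m e" "\<And>e. e \<in> A' \<Longrightarrow> n' e = m' e"
  shows "embeds A n A' n' \<iota> \<longleftrightarrow> embeds A m A' m' \<iota>"
proof -
  have "steps n' (A' - \<iota> ` A) = steps m' (A' - \<iota> ` A)" using assms(2) by (auto intro!: steps_cong)
  then show ?thesis unfolding embeds_def using assms by (auto simp: image_subset_iff)
qed

text \<open>Each step of a connecting walk in the middle set lifts to a walk in the largest set.
  Injectivity of \<open>\<kappa>\<close> keeps the lifted points off the composite image, so no
  intermediate stop counts as a return.\<close>

lemma embeds_trans:
  assumes "embeds A n A' n' \<iota>" "embeds A' n' A'' n'' \<kappa>"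
  shows "embeds A n A'' n'' (\<kappa> \<circ> \<iota>)"
proof -
  have \<iota>: "inj_on \<iota> A" "\<iota> ` A \<subseteq> A'" "\<And>e. e \<in> A \<Longrightarrow> (n' (\<iota> e), \<iota> (n e)) \<in> (steps n' (A' - \<iota> ` A))\<^sup>*"
    and \<kappa>: "inj_on \<kappa> A'" "\<kappa> ` A' \<subseteq> A''"
      "\<And>e. e \<in> A' \<Longrightarrow> (n'' (\<kappa> e), \<kappa> (n' e)) \<in> (steps n'' (A'' - \<kappa> ` A'))\<^sup>*"
    using assms by (auto simp: embeds_def)
  let ?B = "A'' - (\<kappa> \<circ> \<iota>) ` A"
  have sub: "A'' - \<kappa> ` A' \<subseteq> ?B" using \<iota>(2) by auto
  have \<kappa>': "(n'' (\<kappa> e), \<kappa> (n' e)) \<in> (steps n'' ?B)\<^sup>*" if "e \<in> A'" for e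
    using steps_mono[OF sub \<kappa>(3)[OF that]] .
  have lift: "(\<kappa> x, \<kappa> y) \<in> (steps n'' ?B)\<^sup>*" if "(x, y) \<in> (steps n' (A' - \<iota> ` A))\<^sup>*" for x y
    using that
  proof (induction rule: converse_rtrancl_induct)
    case (step x z)
    then have x: "x \<in> A'" "x \<notin> \<iota> ` A" "z = n' x" by (auto simp: steps_iff)
    have "\<kappa> x \<notin> (\<kappa> \<circ> \<iota>) ` A" using x \<iota>(2) \<kappa>(1) by (auto dest: inj_onD)
    then have "(\<kappa> x, n'' (\<kappa> x)) \<in> steps n'' ?B" using x \<kappa>(2) by (auto simp: steps_iff)
    also have "(n'' (\<kappa> x), \<kappa> z) \<in> (steps n'' ?B)\<^sup>*" using \<kappa>' x by simp
    finally show ?case using step by (meson rtrancl_trans trancl_into_rtrancl)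
  qed auto
  show ?thesis unfolding embeds_def
  proof (intro conjI ballI)
    show "inj_on (\<kappa> \<circ> \<iota>) A" using \<iota>(1,2) \<kappa>(1) by (auto intro: comp_inj_on inj_on_subset)
    show "(\<kappa> \<circ> \<iota>) ` A \<subseteq> A''" using \<iota>(2) \<kappa>(2) by auto
    show "(n'' ((\<kappa> \<circ> \<iota>) e), (\<kappa> \<circ> \<iota>) (n e)) \<in> (steps n'' ?B)\<^sup>*" if e: "e \<in> A" for e
      using \<kappa>'[of "\<iota> e"] lift[OF \<iota>(3)[OF e]] \<iota>(2) e by (auto intro: rtrancl_trans)
  qed
qed

lemma embeds_restrict:
  assumes "embeds A n A' n' \<iota>" "B \<subseteq> A" "B' \<subseteq> A'" "\<iota> ` B \<subseteq> B'" "\<And>e. e \<in> B' \<Longrightarrow> n' e \<in> B'"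
  shows "embeds B n B' n' \<iota>"
proof -
  have stay: "(x, y) \<in> (steps n' (B' - \<iota> ` B))\<^sup>*"
    if "(x, y) \<in> (steps n' (A' - \<iota> ` A))\<^sup>*" "x \<in> B'" for x y
    using that
  proof (induction rule: converse_rtrancl_induct)
    case (step x z)
    then have "(x, z) \<in> steps n' (B' - \<iota> ` B)" "z \<in> B'" using assms(2,5) by (auto simp: steps_iff)
    then show ?case using step by (meson converse_rtrancl_into_rtrancl)
  qed auto
  have "inj_on \<iota> B" using assms(1,2) by (auto simp: embeds_def intro: inj_on_subset)
  moreover have "(n' (\<iota> e), \<iota> (n e)) \<in> (steps n' (B' - \<iota> ` B))\<^sup>*" if "e \<in> B" for e
    using that assms(1,2,4,5) by (intro stay) (auto simp: embeds_def)
  ultimately show ?thesis using assms(4) by (auto simp: embeds_def)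
qed

lemma embeds_orbit:
  assumes "embeds A n A' n' \<iota>" "\<And>e. e \<in> A \<Longrightarrow> n e \<in> A" "x \<in> A" "y \<in> A"
  shows "(\<iota> x, \<iota> y) \<in> (steps n' A')\<^sup>* \<longleftrightarrow> (x, y) \<in> (steps n A)\<^sup>*"
proof
  let ?B = "A' - \<iota> ` A"
  have \<iota>: "inj_on \<iota> A" "\<iota> ` A \<subseteq> A'" "\<And>e. e \<in> A \<Longrightarrow> (n' (\<iota> e), \<iota> (n e)) \<in> (steps n' ?B)\<^sup>*"
    using assms(1) by (auto simp: embeds_def)
  {
    assume "(\<iota> x, \<iota> y) \<in> (steps n' A')\<^sup>*"
    \<comment> \<open>The invariant is that the next image arc ahead of the current point comes from
      the orbit of \<open>x\<close>.\<close>
    then have "\<exists>z \<in> A. (x, z) \<in> (steps n A)\<^sup>* \<and> (\<iota> y, \<iota> z) \<in> (steps n' ?B)\<^sup>*"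
    proof (induction rule: rtrancl_induct)
      case base
      then show ?case using assms(3) by auto
    next
      case (step u u')
      then obtain z where z: "z \<in> A" "(x, z) \<in> (steps n A)\<^sup>*" "(u, \<iota> z) \<in> (steps n' ?B)\<^sup>*" by auto
      have u': "u' = n' u" "u \<in> A'" using step(2) by (auto simp: steps_iff)
      show ?case
      proof (cases "u \<in> ?B")
        case True
        then have "u \<noteq> \<iota> z" using z(1) by auto
        then show ?thesis using z steps_first u' by metis
      next
        case False
        then have "u = \<iota> z" using steps_terminal[OF z(3)] by simp
        then have "(u', \<iota> (n z)) \<in> (steps n' ?B)\<^sup>*" using u' \<iota>(3) z by simp
        moreover have "(x, n z) \<in> (steps n A)\<^sup>*"
          using z by (auto intro: steps_extend)
        ultimately show ?thesis using assms(2) z(1) by blast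
      qed
    qed
    then obtain z where z: "z \<in> A" "(x, z) \<in> (steps n A)\<^sup>*" "(\<iota> y, \<iota> z) \<in> (steps n' ?B)\<^sup>*" by auto
    then have "\<iota> z = \<iota> y" using assms(4) by (intro steps_terminal[OF z(3)]) auto
    then show "(x, y) \<in> (steps n A)\<^sup>*" using z \<iota>(1) assms(4) by (auto dest: inj_onD)
  }
  assume "(x, y) \<in> (steps n A)\<^sup>*"
  then show "(\<iota> x, \<iota> y) \<in> (steps n' A')\<^sup>*"
  proof (induction rule: rtrancl_induct)
    case (step u u')
    then have u: "u \<in> A" "u' = n u" by (auto simp: steps_iff)
    have "(\<iota> u, n' (\<iota> u)) \<in> steps n' A'" using u \<iota>(2) by (auto simp: steps_iff)
    moreover have "(n' (\<iota> u), \<iota> u') \<in> (steps n' A')\<^sup>*"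
      using steps_mono[OF Diff_subset \<iota>(3)[OF u(1)]] u by simp
    ultimately show ?case using step(3) by (meson rtrancl_into_rtrancl rtrancl_trans)
  qed auto
qed

section \<open>Insertion of a point into a permutation\<close>

text \<open>For fresh \<open>f\<close>, the choice \<open>p = f\<close> leaves the old permutation
  alone and makes \<open>f\<close> a fixed point, which is the form in which a dummy vertex
  appears.\<close>

definition insert_before :: "('e \<Rightarrow> 'e) \<Rightarrow> 'e \<Rightarrow> 'e \<Rightarrow> 'e \<Rightarrow> 'e" where
  "insert_before n p f x = (if x = f then p else if n x = p then f else n x)"

lemma insert_before_in:
  assumes "\<And>e. e \<in> A \<Longrightarrow> n e \<in> A" "p \<in> insert f A" "e \<in> insert f A"
  shows "insert_before n p f e \<in> insert f A"
  using assms by (auto simp: insert_before_def)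

lemma bij_insert_before:
  assumes "finite A" "bij_betw n A A" "f \<notin> A" "p \<in> insert f A"
  shows "bij_betw (insert_before n p f) (insert f A) (insert f A)"
proof -
  have n: "\<And>e. e \<in> A \<Longrightarrow> n e \<in> A" "inj_on n A" using assms(2) by (auto simp: bij_betw_def)
  let ?N = "insert_before n p f"
  have "inj_on ?N (insert f A)"
    using n assms(3,4) unfolding inj_on_def insert_before_def by (auto split: if_splits)
  moreover have "?N ` insert f A \<subseteq> insert f A" using insert_before_in[of A n p f] n(1) assms(4) by blast
  ultimately show ?thesis using assms(1) endo_inj_surj[of "insert f A" ?N] by (simp add: bij_betw_def)
qed

context
  fixes n :: "'e \<Rightarrow> 'e" and B p f N
  assumes f: "f \<notin> B"
  defines "N \<equiv> insert_before n p f"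
begin

text \<open>If \<open>p\<close> cannot reach \<open>y\<close>, the walk never visits
  \<open>p\<close>, and inside \<open>B\<close> only steps into \<open>p\<close> are
  changed.\<close>

lemma insert_before_steps_avoid:
  assumes "(x, y) \<in> (steps n B)\<^sup>*" "(p, y) \<notin> (steps n B)\<^sup>*"
  shows "(x, y) \<in> (steps N B)\<^sup>*"
  using assms
proof (induction rule: converse_rtrancl_induct)
  case (step x z)
  then have "(x, z) \<in> steps N B" using f by (auto simp: steps_iff N_def insert_before_def)
  then show ?case using step by (meson converse_rtrancl_into_rtrancl)
qed auto

text \<open>The strict closure records that the diversion happens on entering \<open>p\<close> after
  at least one step. For \<open>x = p\<close> this would be a cycle, which
  \<open>steps_acyclic\<close> excludes for walks that leave \<open>B\<close>.\<close>

lemma insert_before_steps_meet: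
  assumes "(x, y) \<in> (steps n B)\<^sup>*"
  shows "(x, y) \<in> (steps N B)\<^sup>* \<or> (x, f) \<in> (steps N B)\<^sup>* \<and> (x, p) \<in> (steps n B)\<^sup>+"
  using assms
proof (induction rule: converse_rtrancl_induct)
  case (step x z)
  show ?case
  proof (cases "z = p")
    case True
    then have "(x, f) \<in> steps N B" "(x, p) \<in> steps n B"
      using step f by (auto simp: steps_iff N_def insert_before_def)
    then show ?thesis by auto
  next
    case False
    then have "(x, z) \<in> steps N B" using step f by (auto simp: steps_iff N_def insert_before_def)
    then show ?thesis using step by (meson converse_rtrancl_into_rtrancl trancl_into_trancl2)
  qed
qed auto

lemma insert_before_steps_hit:
  assumes "(x, p) \<in> (steps n B)\<^sup>*" "x \<noteq> p"
  shows "(x, f) \<in> (steps N B)\<^sup>*"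
  using assms
proof (induction rule: converse_rtrancl_induct)
  case (step x z)
  show ?case
  proof (cases "z = p")
    case True
    then have "(x, f) \<in> steps N B"
      using step f by (auto simp: steps_iff N_def insert_before_def)
    then show ?thesis by auto
  next
    case False
    then have "(x, z) \<in> steps N B" using step f by (auto simp: steps_iff N_def insert_before_def)
    then show ?thesis using step False by (meson converse_rtrancl_into_rtrancl)
  qed
qed auto

lemma insert_before_steps_conv:
  assumes "(x, y) \<in> (steps N B)\<^sup>*" "(x, p) \<notin> (steps n B)\<^sup>*"
  shows "(x, y) \<in> (steps n B)\<^sup>*"
  using assms
proof (induction rule: rtrancl_induct)
  case (step y z)
  then have y: "(x, y) \<in> (steps n B)\<^sup>*" "y \<in> B" "z = N y" by (auto simp: steps_iff)
  then have "(x, n y) \<in> (steps n B)\<^sup>*" by (auto intro: steps_extend)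
  moreover have "z = n y" using calculation y f assms(2) by (auto simp: N_def insert_before_def)
  ultimately show ?case by simp
qed auto

end

text \<open>The larger permutation gets its new point before \<open>p'\<close>, the smaller one gets
  \<open>f\<close> before \<open>p\<close>. The value \<open>p = f\<close> encodes a walk from
  \<open>p'\<close> that never meets the image, so that \<open>f\<close> becomes a fixed
  point.\<close>

definition lands :: "'e set \<Rightarrow> 'f set \<Rightarrow> ('f \<Rightarrow> 'f) \<Rightarrow> ('e \<Rightarrow> 'f) \<Rightarrow> 'f \<Rightarrow> 'e \<Rightarrow> 'e \<Rightarrow> bool" where
  "lands A A' n' \<iota> p' p f \<longleftrightarrow>
     (if p = f then \<forall>e \<in> A. (p', \<iota> e) \<notin> (steps n' (A' - \<iota> ` A))\<^sup>*
      else p \<in> A \<and> (p', \<iota> p) \<in> (steps n' (A' - \<iota> ` A))\<^sup>*)"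

text \<open>The point \<open>F\<close> enters just ahead of \<open>p'\<close>, so the next image arc
  after it is the image of \<open>p\<close>. Old connecting walks ending there meet
  \<open>p'\<close> and now stop at \<open>F\<close>; all others avoid \<open>p'\<close>, since
  otherwise \<open>p'\<close> would land elsewhere.\<close>

lemma embeds_insert:
  assumes emb: "embeds A n A' n' \<iota>" and n: "\<And>e. e \<in> A \<Longrightarrow> n e \<in> A"
    and n': "finite A'" "bij_betw n' A' A'"
    and f: "f \<notin> A" and F: "F \<notin> A'" and p': "p' \<in> insert F A'"
    and lands: "lands A A' n' \<iota> p' p f"
  shows "embeds (insert f A) (insert_before n p f) (insert F A') (insert_before n' p' F) (\<iota>(f := F))"
proof -
  let ?B = "A' - \<iota> ` A" and ?N = "insert_before n p f" and ?N' = "insert_before n' p' F" and ?\<iota> = "\<iota>(f := F)"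
  have \<iota>: "inj_on \<iota> A" "\<iota> ` A \<subseteq> A'" "\<And>e. e \<in> A \<Longrightarrow> (n' (\<iota> e), \<iota> (n e)) \<in> (steps n' ?B)\<^sup>*"
    using emb by (auto simp: embeds_def)
  have n'A: "\<And>e. e \<in> A' \<Longrightarrow> n' e \<in> A'" and n'inj: "inj_on n' A'" using n'(2) by (auto simp: bij_betw_def)
  have FB: "F \<notin> ?B" using F by simp
  have im: "?\<iota> ` insert f A = insert F (\<iota> ` A)" using f by auto
  have B: "insert F A' - ?\<iota> ` insert f A = ?B" unfolding im using F by auto
  have main: "(?N' (?\<iota> e), ?\<iota> (?N e)) \<in> (steps ?N' ?B)\<^sup>*" if e: "e \<in> insert f A" for e
  proof (cases "e = f")
    case ef: True
    show ?thesis
    proof (cases "p = f")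
      case False
      then have p: "p \<in> A" "(p', \<iota> p) \<in> (steps n' ?B)\<^sup>*" using lands by (auto simp: lands_def)
      have "(p', p') \<notin> (steps n' ?B)\<^sup>+" using p(1) by (intro steps_acyclic[OF p(2)]) auto
      then have "(p', \<iota> p) \<in> (steps ?N' ?B)\<^sup>*" using insert_before_steps_meet[OF FB p(2)] by metis
      then show ?thesis using ef False by (simp add: insert_before_def)
    next
      case True
      then have miss: "(p', \<iota> e) \<notin> (steps n' ?B)\<^sup>*" if "e \<in> A" for e using lands that by (auto simp: lands_def)
      have "(p', F) \<in> (steps ?N' ?B)\<^sup>*"
      proof (cases "p' = F")
        case False
        then have p'A: "p' \<in> A'" using p' by simp
        \<comment> \<open>The walk from \<open>p'\<close> stays outside the image forever, so it
          closes up to a cycle; the point preceding \<open>p'\<close> on it now leads to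
          \<open>F\<close>.\<close>
        let ?S = "(steps n' ?B)\<^sup>* `` {p'}"
        have SA: "?S \<subseteq> A'" using n'A p'A by (auto elim!: steps_invariant)
        then have SB: "?S \<subseteq> ?B" using miss by auto
        have "n' ` ?S = ?S"
        proof (rule endo_inj_surj)
          show "finite ?S" using SA n'(1) finite_subset by blast
          show "n' ` ?S \<subseteq> ?S" using SB by (auto intro: steps_extend)
          show "inj_on n' ?S" using SA n'inj inj_on_subset by blast
        qed
        moreover have "p' \<in> ?S" by auto
        ultimately obtain y where y: "y \<in> ?S" "n' y = p'" by (metis imageE)
        then have "(y, F) \<in> steps ?N' ?B" using SB FB by (auto simp: steps_iff insert_before_def)
        moreover have "(p', y) \<in> (steps n' ?B)\<^sup>*" using y by simp
        ultimately show ?thesis using insert_before_steps_meet[OF FB, of p' y n' p']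
          by (meson rtrancl_into_rtrancl)
      qed auto
      then show ?thesis using ef True by (simp add: insert_before_def)
    qed
  next
    case False
    then have eA: "e \<in> A" using e by simp
    then have \<iota>e: "\<iota> e \<in> A'" "\<iota> e \<noteq> F" using \<iota>(2) F by auto
    show ?thesis
    proof (cases "n e = p")
      case True
      then have p: "p \<in> A" "p \<noteq> f" using n eA f by auto
      then have land: "(p', \<iota> p) \<in> (steps n' ?B)\<^sup>*" using lands by (auto simp: lands_def)
      \<comment> \<open>Walks backwards from \<open>\<iota> p\<close> are unique, so one of
        \<open>p'\<close> and \<open>n' (\<iota> e)\<close> lies on the way from the other to
        \<open>\<iota> p\<close>. The only predecessor of \<open>n' (\<iota> e)\<close> is an image
        arc, so the walk from \<open>p'\<close> cannot run into it from outside the image.\<close>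
      have sv: "single_valued ((steps n' ?B)\<inverse>)"
        using n'inj by (auto simp: single_valued_def steps_iff dest: inj_onD)
      have "(\<iota> p, n' (\<iota> e)) \<in> ((steps n' ?B)\<inverse>)\<^sup>*" "(\<iota> p, p') \<in> ((steps n' ?B)\<inverse>)\<^sup>*"
        using \<iota>(3)[OF eA] land True by (auto simp: rtrancl_converse)
      from single_valued_confluent[OF sv this]
      have "(p', n' (\<iota> e)) \<in> (steps n' ?B)\<^sup>* \<or> (n' (\<iota> e), p') \<in> (steps n' ?B)\<^sup>*"
        by (auto simp: rtrancl_converse)
      moreover have "p' = n' (\<iota> e)" if "(p', n' (\<iota> e)) \<in> (steps n' ?B)\<^sup>*"
        using that
      proof (cases rule: rtranclE)
        case (step z)
        then have "z \<in> ?B" "n' z = n' (\<iota> e)" by (auto simp: steps_iff)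
        then show ?thesis using n'inj \<iota>e eA by (metis Diff_iff imageI inj_onD)
      qed
      ultimately have reach: "(n' (\<iota> e), p') \<in> (steps n' ?B)\<^sup>*" by auto
      have "(?N' (\<iota> e), F) \<in> (steps ?N' ?B)\<^sup>*"
        using insert_before_steps_hit[OF FB reach] \<iota>e by (auto simp: insert_before_def)
      then show ?thesis using False True by (simp add: insert_before_def)
    next
      case ne: False
      have "(p', \<iota> (n e)) \<notin> (steps n' ?B)\<^sup>*"
      proof
        assume a: "(p', \<iota> (n e)) \<in> (steps n' ?B)\<^sup>*"
        then have "p \<in> A" "(p', \<iota> p) \<in> (steps n' ?B)\<^sup>*"
          using lands n eA by (auto simp: lands_def split: if_splits)
        with a have "\<iota> (n e) = \<iota> p" using n eA by (intro steps_end_unique[OF a]) auto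
        then show False using ne \<iota>(1) n eA \<open>p \<in> A\<close> by (auto dest: inj_onD)
      qed
      with insert_before_steps_avoid[OF FB \<iota>(3)[OF eA] this]
      show ?thesis using \<iota>(3)[OF eA] False ne \<iota>e f n[OF eA] by (auto simp: insert_before_def)
    qed
  qed
  have "inj_on ?\<iota> (insert f A)" using \<iota>(1,2) f F by (auto simp: inj_on_def)
  moreover have "?\<iota> ` insert f A \<subseteq> insert F A'" unfolding im using \<iota>(2) by auto
  ultimately show ?thesis unfolding embeds_def B using main by blast
qed

section \<open>Exchange of two successors\<close>

text \<open>This is \<open>n\<close> composed with the transposition of \<open>f\<close> and
  \<open>f'\<close>.\<close>

definition swap_images :: "('e \<Rightarrow> 'e) \<Rightarrow> 'e \<Rightarrow> 'e \<Rightarrow> 'e \<Rightarrow> 'e" where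
  "swap_images n f f' = n(f := n f', f' := n f)"

lemma swap_images_commute: "swap_images n f f' = swap_images n f' f"
  by (auto simp: swap_images_def)

text \<open>The connecting walks only use arcs outside the image, where nothing is changed.\<close>

lemma embeds_swap_images:
  assumes "embeds A n A' n' \<iota>" "f \<in> A" "f' \<in> A"
  shows "embeds A (swap_images n f f') A' (swap_images n' (\<iota> f) (\<iota> f')) \<iota>"
proof -
  let ?N' = "swap_images n' (\<iota> f) (\<iota> f')"
  have \<iota>: "inj_on \<iota> A" using assms(1) by (auto simp: embeds_def)
  have s: "steps ?N' (A' - \<iota> ` A) = steps n' (A' - \<iota> ` A)"
    using assms(2,3) by (intro steps_cong) (auto simp: swap_images_def)
  have "\<iota> e = \<iota> e2 \<longleftrightarrow> e = e2" if "e \<in> A" "e2 \<in> A" for e e2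
    using \<iota> that by (auto dest: inj_onD)
  then show ?thesis using assms unfolding embeds_def s by (auto simp: swap_images_def)
qed

lemma bij_swap_images:
  assumes "bij_betw n A A" "f \<in> A" "f' \<in> A"
  shows "bij_betw (swap_images n f f') A A"
proof -
  have "swap_images n f f' ` A = n ` A"
    using assms(2,3) by (force simp: swap_images_def image_iff)
  moreover have "inj_on (swap_images n f f') A"
    using assms by (auto simp: swap_images_def inj_on_def bij_betw_def)
  ultimately show ?thesis using assms(1) by (auto simp: bij_betw_def)
qed

lemma orbit_swap_images:
  assumes A: "finite A" "bij_betw n A A" "f \<in> A" "f' \<in> A" "f \<noteq> f'"
  shows "(f, f') \<in> (steps (swap_images n f f') A)\<^sup>* \<longleftrightarrow> (f, f') \<notin> (steps n A)\<^sup>*"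
proof -
  let ?N = "swap_images n f f'"
  have N: "?N f = n f'" "?N f' = n f" "\<And>x. x \<noteq> f \<Longrightarrow> x \<noteq> f' \<Longrightarrow> ?N x = n x"
    using A(5) by (auto simp: swap_images_def)
  have NA: "bij_betw ?N A A" by (rule bij_swap_images) fact+
  have False if a: "(f, f') \<in> (steps n A)\<^sup>*" and b: "(f', f) \<in> (steps ?N A)\<^sup>*"
  proof -
    let ?R = "steps n (A - {f'})"
    \<comment> \<open>Walking on from \<open>f\<close>, the permutation \<open>n\<close> meets
      \<open>f'\<close> before it returns to \<open>f\<close>; otherwise everything reachable from
      \<open>f\<close> would reach \<open>f\<close> without a step out of \<open>f'\<close>,
      including \<open>f'\<close> itself.\<close>
    have no: "(n f, f) \<notin> ?R\<^sup>*"
    proof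
      assume nf: "(n f, f) \<in> ?R\<^sup>*"
      have "f' \<in> {x. (x, f) \<in> ?R\<^sup>*}"
        using a
      proof (rule steps_invariant)
        fix z assume "z \<in> {x. (x, f) \<in> ?R\<^sup>*}"
        then show "n z \<in> {x. (x, f) \<in> ?R\<^sup>*}" using nf steps_first by (cases "z = f") auto
      qed auto
      then have "f = f'" using steps_terminal[of f' f n "A - {f'}"] by auto
      then show False using A(5) by simp
    qed
    \<comment> \<open>After the exchange \<open>f'\<close> leads to \<open>n f\<close>, so its new
      cycle consists of the segment from \<open>n f\<close> up to \<open>f'\<close>, which misses
      \<open>f\<close>.\<close>
    have "f \<in> insert f' (?R\<^sup>* `` {n f})"
      using b
    proof (rule steps_invariant)
      fix z assume z: "z \<in> A" "z \<in> insert f' (?R\<^sup>* `` {n f})"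
      show "?N z \<in> insert f' (?R\<^sup>* `` {n f})"
      proof (cases "z = f'")
        case False
        then have "(n f, z) \<in> ?R\<^sup>*" "z \<noteq> f" using z no by auto
        moreover from this have "(n f, n z) \<in> ?R\<^sup>*" using z False by (auto intro: steps_extend)
        ultimately show ?thesis using False N(3) by auto
      qed (simp add: N)
    qed auto
    then show False using no A(5) by auto
  qed
  moreover have False if a: "(f, f') \<notin> (steps n A)\<^sup>*" and b: "(f, f') \<notin> (steps ?N A)\<^sup>*"
  proof -
    let ?U = "(steps ?N A)\<^sup>* `` {f}" and ?W = "(steps n A)\<^sup>* `` {f}"
    note U = orbit_image[OF A(1) NA A(3)] and W = orbit_image[OF A(1-3)]
    \<comment> \<open>Away from \<open>f\<close> and \<open>f'\<close> both permutations agree, so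
      going back along \<open>n\<close> stays in the intersection and never lands on
      \<open>f\<close>. The intersection would then be covered by the image of a proper subset of
      itself.\<close>
    have "?U \<inter> ?W \<subseteq> n ` (?U \<inter> ?W - {f})"
    proof
      fix x assume x: "x \<in> ?U \<inter> ?W"
      then obtain y where y: "y \<in> ?W" "x = n y" using W(2) by blast
      have yf': "y \<noteq> f'" using y(1) a by auto
      have pre: "z \<in> ?U" if z: "z \<in> A" "?N z \<in> ?U" for z
      proof -
        obtain z' where "z' \<in> ?U" "?N z = ?N z'" using U(2) z(2) by (metis (no_types, lifting) imageE)
        then show ?thesis using z(1) U(1) NA by (metis bij_betw_def inj_onD subsetD)
      qed
      have "y \<noteq> f" using pre[OF A(4)] N(2) x y b by auto
      moreover have "y \<in> ?U" using pre[of y] N(3)[of y] x y yf' calculation W(1) by auto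
      ultimately show "x \<in> n ` (?U \<inter> ?W - {f})" using y by auto
    qed
    moreover have fin: "finite (?U \<inter> ?W)" using U(1) A(1) finite_subset by blast
    ultimately have "card (?U \<inter> ?W) \<le> card (?U \<inter> ?W - {f})"
      by (meson card_image_le card_mono dual_order.trans finite_Diff finite_imageI)
    moreover have "f \<in> ?U \<inter> ?W" by auto
    ultimately show False using fin card_Diff1_less[OF fin] by (metis leD)
  qed
  ultimately show ?thesis using orbit_sym[OF A(1) NA] by metis
qed

section \<open>Cuts as operations on successor functions\<close>

definition nxt :: "('v, 'e) pre_digraph \<Rightarrow> 'e \<Rightarrow> 'e" where
  "nxt D e = the_inv_into (arcs D) (tail D) (head D e)"

text \<open>The balance is stated on arcs alone, without \<open>verts\<close>, so that it passes to
  contractions without a look at merged or isolated vertices.\<close>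

definition arc_cycles :: "('v, 'e) pre_digraph \<Rightarrow> bool" where
  "arc_cycles D \<longleftrightarrow> finite (arcs D) \<and> inj_on (tail D) (arcs D) \<and> inj_on (head D) (arcs D) \<and>
     head D ` arcs D = tail D ` arcs D"

lemma arc_cyclesI: "fin_digraph D \<Longrightarrow> deg_one D \<Longrightarrow> arc_cycles D"
  by (auto simp: arc_cycles_def deg_one_def bij_betw_def fin_digraph.finite_arcs)

lemma nxt_eq:
  assumes "inj_on (tail D) (arcs D)" "e' \<in> arcs D" "tail D e' = head D e"
  shows "nxt D e = e'"
  unfolding nxt_def using assms by (metis the_inv_into_f_f)

lemma nxt:
  assumes "arc_cycles D" "e \<in> arcs D"
  shows "nxt D e \<in> arcs D" "tail D (nxt D e) = head D e"
proof -
  obtain e' where "e' \<in> arcs D" "tail D e' = head D e"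
    using assms by (metis arc_cycles_def imageE imageI)
  then show "nxt D e \<in> arcs D" "tail D (nxt D e) = head D e"
    using nxt_eq assms(1) by (metis arc_cycles_def)+
qed

lemma bij_nxt:
  assumes "arc_cycles D"
  shows "bij_betw (nxt D) (arcs D) (arcs D)"
proof -
  have "inj_on (nxt D) (arcs D)"
    using assms nxt[OF assms] by (metis (no_types, lifting) arc_cycles_def inj_on_def)
  moreover have "nxt D ` arcs D \<subseteq> arcs D" using nxt(1)[OF assms] by auto
  ultimately show ?thesis
    using assms endo_inj_surj[of "arcs D" "nxt D"] by (simp add: bij_betw_def arc_cycles_def)
qed

lemma arcs_induce: "arcs (E \<restriction> U) = {e \<in> arcs E. tail E e \<in> U \<and> head E e \<in> U}"
  by (auto simp: induce_subgraph_def)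

lemma nxt_restrict:
  assumes "arc_cycles E" "closed_in E U" "e \<in> arcs (E \<restriction> U)"
  shows "nxt (E \<restriction> U) e = nxt E e" "nxt E e \<in> arcs (E \<restriction> U)"
proof -
  have e: "e \<in> arcs E" "head E e \<in> U" using assms(3) by (auto simp: arcs_induce)
  note n = nxt[OF assms(1) e(1)]
  have "head E (nxt E e) \<in> U" using n e(2) assms(2) unfolding closed_in_def by metis
  then show in': "nxt E e \<in> arcs (E \<restriction> U)"
    using n e(2) by (simp add: arcs_induce)
  have "inj_on (tail E) (arcs (E \<restriction> U))"
    using assms(1) by (auto simp: arc_cycles_def arcs_induce intro: inj_on_subset)
  then show "nxt (E \<restriction> U) e = nxt E e"
    using n(2) in' by (intro nxt_eq) (auto simp: induce_subgraph_def)
qed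

lemma orbit_closed_in:
  assumes "arc_cycles E" "closed_in E U" "(e, e') \<in> (steps (nxt E) (arcs E))\<^sup>*" "tail E e \<in> U"
  shows "tail E e' \<in> U"
  using assms(3)
proof (rule steps_invariant[where U = "{x. tail E x \<in> U}", simplified])
  show "tail E e \<in> U" by fact
  show "tail E (nxt E z) \<in> U" if "z \<in> arcs E" "tail E z \<in> U" for z
    using that nxt[OF assms(1)] assms(2) by (auto simp: closed_in_def)
qed

text \<open>Together with \<open>component_least\<close> this bounds a weak component by the tails
  of a directed orbit.\<close>

lemma closed_in_tails_orbit:
  assumes "arc_cycles E" "e \<in> arcs E"
  shows "closed_in E (tail E ` ((steps (nxt E) (arcs E))\<^sup>* `` {e}))"
proof -
  let ?O = "(steps (nxt E) (arcs E))\<^sup>* `` {e}"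
  have fin: "finite (arcs E)" and inj: "inj_on (tail E) (arcs E)" using assms(1) by (auto simp: arc_cycles_def)
  note O = orbit_image[OF fin bij_nxt[OF assms(1)] assms(2)]
  have mem: "tail E x \<in> tail E ` ?O \<longleftrightarrow> x \<in> ?O" if "x \<in> arcs E" for x
    by (rule inj_on_image_mem_iff[OF inj that O(1)])
  show ?thesis unfolding closed_in_def
  proof
    fix x assume x: "x \<in> arcs E"
    have "nxt E x \<in> ?O \<longleftrightarrow> x \<in> ?O"
      using inj_on_image_mem_iff[OF _ x O(1), of "nxt E"] O(2) bij_nxt[OF assms(1)]
      by (simp only: bij_betw_def)
    then show "tail E x \<in> tail E ` ?O \<longleftrightarrow> head E x \<in> tail E ` ?O"
      using mem[OF x] mem[OF nxt(1)[OF assms(1) x]] nxt(2)[OF assms(1) x] by simp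
  qed
qed

lemma component_eq:
  assumes "wf_digraph D" "x \<in> verts D" "y \<in> component D x"
  shows "component D y = component D x"
proof -
  have y: "y \<in> verts D" using assms(3) component_sub by (metis subsetD)
  have xy: "(x, y) \<in> (nbr D)\<^sup>*" using assms component_conv by fastforce
  with nbrs_sym have "(y, x) \<in> (nbr D)\<^sup>*" by metis
  with xy show ?thesis unfolding component_conv[OF assms(1,2)] component_conv[OF assms(1) y]
    by (intro Collect_cong) (metis rtrancl_trans)
qed

section \<open>Subdivision at Marker's vertices\<close>

text \<open>The default \<open>d\<close> is for vertices outside the digraph. When the arc to be
  inserted is passed as \<open>d\<close>, a dummy vertex falls into the case of
  \<open>insert_before\<close> that creates a fixed point.\<close>

definition out_arc :: "('v, 'e) pre_digraph \<Rightarrow> 'v \<Rightarrow> 'e \<Rightarrow> 'e" where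
  "out_arc D v d = (if v \<in> verts D then the_inv_into (arcs D) (tail D) v else d)"

lemma out_arc_notin: "v \<notin> verts D \<Longrightarrow> out_arc D v d = d"
  by (simp add: out_arc_def)

lemma out_arc:
  assumes "deg_one D" "v \<in> verts D"
  shows "out_arc D v d \<in> arcs D" "tail D (out_arc D v d) = v"
proof -
  obtain e where "e \<in> arcs D" "tail D e = v" using deg_oneD(3)[OF assms] by auto
  then have "the_inv_into (arcs D) (tail D) v = e"
    using assms(1) by (auto simp: deg_one_def bij_betw_def the_inv_into_f_f)
  then show "out_arc D v d \<in> arcs D" "tail D (out_arc D v d) = v"
    using assms(2) \<open>e \<in> arcs D\<close> \<open>tail D e = v\<close> by (auto simp: out_arc_def)
qed

lemma out_arc_tail:
  assumes "wf_digraph D" "deg_one D" "e \<in> arcs D"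
  shows "out_arc D (tail D e) d = e"
  using assms deg_oneD(1)[OF assms(2)] out_arc[OF assms(2)] wf_digraph.tail_in_verts by metis

text \<open>
  Cutting at \<open>v\<close> and \<open>w\<close> amounts to subdividing the cycles at \<open>v\<close> by \<open>f'\<close> and at \<open>w\<close> by \<open>f\<close>
  (a dummy vertex giving a loop) and then interchanging the successors of \<open>f\<close> and \<open>f'\<close>.
\<close>

definition subdivided :: "('v, 'e) pre_digraph \<Rightarrow> 'v \<Rightarrow> 'v \<Rightarrow> 'e \<Rightarrow> 'e \<Rightarrow> 'e \<Rightarrow> 'e" where
  "subdivided D v w f f' =
    insert_before (insert_before (nxt D) (out_arc D v f') f')
      (if v = w then f' else out_arc D w f) f"

lemma subdivided_bij:
  assumes "fin_digraph D" "deg_one D" "f \<notin> arcs D" "f' \<notin> arcs D" "f \<noteq> f'"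
  shows "bij_betw (subdivided D v w f f') (insert f (insert f' (arcs D))) (insert f (insert f' (arcs D)))"
  unfolding subdivided_def
proof (intro bij_insert_before)
  show "bij_betw (nxt D) (arcs D) (arcs D)" by (rule bij_nxt[OF arc_cyclesI]) fact+
  show "finite (arcs D)" using assms(1) by (rule fin_digraph.finite_arcs)
  then show "finite (insert f' (arcs D))" by simp
  show "f \<notin> insert f' (arcs D)" using assms by auto
  show "out_arc D v f' \<in> insert f' (arcs D)"
    using out_arc(1)[OF assms(2)] by (cases "v \<in> verts D") (auto simp: out_arc_notin)
  show "(if v = w then f' else out_arc D w f) \<in> insert f (insert f' (arcs D))"
    using out_arc(1)[OF assms(2)] by (cases "w \<in> verts D") (auto simp: out_arc_notin)
qed fact

text \<open>The arcs \<open>f\<close> and \<open>f'\<close> subdivide at \<open>w\<close> and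
  \<open>v\<close> and so mark the cycles of these vertices. A cycle of \<open>f\<close> missing
  \<open>f'\<close> gives a closed vertex set separating \<open>w\<close> from \<open>v\<close>, and
  conversely.\<close>

lemma same_component_iff_subdivided:
  assumes "fin_digraph D" "deg_one D" "f \<notin> arcs D" "f' \<notin> arcs D" "f \<noteq> f'"
  shows "same_component D v w \<longleftrightarrow>
    (f, f') \<in> (steps (subdivided D v w f f') (insert f (insert f' (arcs D))))\<^sup>*"
    (is "_ \<longleftrightarrow> _ \<in> (steps ?n ?A)\<^sup>*")
proof (cases "v = w")
  case True
  then have "?n f = f'" by (simp add: subdivided_def insert_before_def)
  then have "(f, f') \<in> steps ?n ?A" by (simp add: steps_iff)
  then show ?thesis using True by (auto simp: same_component_def)
next
  case vw: False
  interpret fin_digraph D by fact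
  have ac: "arc_cycles D" by (rule arc_cyclesI) fact+
  let ?D = "add_points D v w"
  have D: "verts ?D = verts D \<union> {v, w}" "arcs ?D = arcs D" "tail ?D = tail D" "head ?D = head D"
    by (auto simp: add_points_def)
  have wf: "wf_digraph ?D" by unfold_locales (auto simp: D)
  define a b where "a = out_arc D v f'" and "b = out_arc D w f"
  have a: "(v \<in> verts D \<and> a \<in> arcs D \<and> tail D a = v) \<or> (v \<notin> verts D \<and> a = f')"
    and b: "(w \<in> verts D \<and> b \<in> arcs D \<and> tail D b = w) \<or> (w \<notin> verts D \<and> b = f)"
    using out_arc[OF assms(2)] by (auto simp: a_def b_def out_arc_def)
  have ab: "a \<noteq> b" using a b vw assms by auto
  have n: "?n x = (if x = f then b else
      if (if x = f' then a else if nxt D x = a then f' else nxt D x) = b then f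
      else if x = f' then a else if nxt D x = a then f' else nxt D x)" for x
    using vw by (auto simp: subdivided_def insert_before_def a_def[symmetric] b_def[symmetric])
  show ?thesis
  proof
    assume same: "same_component D v w"
    show "(f, f') \<in> (steps ?n ?A)\<^sup>*"
    proof (rule ccontr)
      assume neg: "(f, f') \<notin> (steps ?n ?A)\<^sup>*"
      define W where "W = (steps ?n ?A)\<^sup>* `` {f}"
      have finA: "finite ?A" by simp
      note bij = subdivided_bij[OF assms, of v w]
      have W: "f \<in> W" "f' \<notin> W" using neg by (auto simp: W_def)
      have WA: "W \<subseteq> ?A" "?n ` W = W"
        using orbit_image[OF finA bij, of f] by (auto simp: W_def)
      have Wiff: "?n x \<in> W \<longleftrightarrow> x \<in> W" if "x \<in> ?A" for x
        using inj_on_image_mem_iff[OF _ that WA(1), of ?n] WA(2) bij by (simp only: bij_betw_def)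
      have aW: "a \<notin> W"
        using Wiff[of f'] W a b ab assms by (auto simp: n split: if_splits)
      have bW: "b \<in> W" using Wiff[of f] W by (auto simp: n)
      have key: "nxt D x \<in> W \<longleftrightarrow> x \<in> W" if x: "x \<in> arcs D" for x
        using Wiff[of x] x aW bW W nxt(1)[OF ac x] assms by (auto simp: n split: if_splits)
      have tW: "tail D x \<in> tail D ` (W \<inter> arcs D) \<longleftrightarrow> x \<in> W" if "x \<in> arcs D" for x
        using that deg_oneD(1)[OF assms(2)] by (auto simp: image_iff)
      \<comment> \<open>The vertex \<open>w\<close> is added by hand because a dummy
        \<open>w\<close> is the tail of no arc.\<close>
      let ?U = "insert w (tail D ` (W \<inter> arcs D))"
      have tU: "tail D x \<in> ?U \<longleftrightarrow> x \<in> W" if "x \<in> arcs D" for x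
        using that tW[OF that] b bW deg_oneD(1)[OF assms(2)] by (metis insert_iff tail_in_verts)
      have "closed_in ?D ?U" unfolding closed_in_def D
        using tU key nxt[OF ac] by metis
      then have "component ?D w \<subseteq> ?U" by (intro component_least[OF wf]) (auto simp: D)
      moreover have "v \<in> component ?D w"
        using same component_self[of v ?D] by (auto simp: same_component_def D)
      moreover have "v \<notin> ?U" using a aW vw tW by auto
      ultimately show False by auto
    qed
  next
    assume orb: "(f, f') \<in> (steps ?n ?A)\<^sup>*"
    show "same_component D v w"
    proof (rule ccontr)
      assume neg: "\<not> same_component D v w"
      let ?C = "component ?D w"
      have "w \<in> ?C" by (rule component_self) (simp add: D)
      have cl: "closed_in ?D ?C" by (rule component_closed[OF wf]) (simp add: D)
      have vC: "v \<notin> ?C"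
        using neg component_eq[OF wf, of w v] by (auto simp: same_component_def D)
      have "f' \<in> insert f {e \<in> arcs D. tail D e \<in> ?C}"
        using orb
      proof (rule steps_invariant)
        fix z assume z: "z \<in> insert f {e \<in> arcs D. tail D e \<in> ?C}"
        show "?n z \<in> insert f {e \<in> arcs D. tail D e \<in> ?C}"
        proof (cases "z = f")
          case True
          then show ?thesis using b \<open>w \<in> ?C\<close> by (auto simp: n)
        next
          case False
          then have z': "z \<in> arcs D" "tail D z \<in> ?C" "z \<noteq> f'" using z assms by auto
          then have "head D z \<in> ?C" using cl by (auto simp: closed_in_def D)
          then have nz: "nxt D z \<in> arcs D" "tail D (nxt D z) \<in> ?C" using nxt[OF ac z'(1)] by auto
          then have "nxt D z \<noteq> a" using a vC assms by auto
          then show ?thesis using nz False z' by (auto simp: n)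
        qed
      qed auto
      then show False using assms by auto
    qed
  qed
qed

section \<open>Cycles and components after a cut\<close>

context
  fixes D :: "('v, 'e) pre_digraph" and v w v1 v2 w1 w2 :: 'v and f f' :: 'e and S E
  assumes fin: "fin_digraph D" and deg: "deg_one D"
    and fr: "fresh_split D v w v1 v2 w1 w2" and f: "f \<notin> arcs D" "f' \<notin> arcs D" "f \<noteq> f'"
  defines "S \<equiv> split_points D v w v1 v2 w1 w2"
    and "E \<equiv> add_edge (add_edge S f w2 v1) f' v2 w1"
begin

interpretation fin_digraph D by (rule fin)

private lemmas E_verts = cut_E_verts[OF fin deg fr f, folded S_def, folded E_def]
  and E_arcs = cut_E_arcs[OF fin deg fr f, folded S_def, folded E_def]
  and E_tail = cut_E_tail[OF fin deg fr f, folded S_def, folded E_def]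
  and E_head = cut_E_head[OF fin deg fr f, folded S_def, folded E_def]
  and E_deg = cut_E_deg[OF fin deg fr f, folded S_def, folded E_def]
  and E_fin = cut_E_fin[OF fin deg fr f, folded S_def, folded E_def]
  and S_verts = cut_S_verts[OF fin deg fr f, folded S_def]
  and S_arcs = cut_S_arcs[OF fin deg fr f, folded S_def]
  and S_tail = cut_S_tail[OF fin deg fr f, folded S_def]
  and S_head = cut_S_head[OF fin deg fr f, folded S_def]
  and S_wf = cut_S_wf[OF fin deg fr f, folded S_def]
  and P_closed = cut_P_closed[OF fin deg fr f, folded S_def, folded E_def]
  and P'_closed = cut_P'_closed[OF fin deg fr f, folded S_def, folded E_def]
  and K_closed = cut_K_closed[OF fin deg fr f, folded S_def, folded E_def]

lemma cut_arc_cycles: "arc_cycles E"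
  by (rule arc_cyclesI[OF E_fin E_deg])

text \<open>Tails are injective in \<open>E\<close>, so it suffices that the right-hand side is an
  arc of \<open>E\<close> starting at the head of \<open>e\<close>. For \<open>v = w\<close> the new
  arcs are consecutive before the exchange, and afterwards \<open>f'\<close> is a loop, closing the
  trivial path.\<close>

lemma nxt_cut:
  assumes "e \<in> arcs E"
  shows "nxt E e = swap_images (subdivided D v w f f') f f' e"
proof -
  have ac: "arc_cycles D" by (rule arc_cyclesI[OF fin deg])
  define a b where "a = out_arc D v f'" and "b = out_arc D w f"
  have a: "(v \<in> verts D \<and> a \<in> arcs D \<and> tail D a = v) \<or> (v \<notin> verts D \<and> a = f')"
    and b: "(w \<in> verts D \<and> b \<in> arcs D \<and> tail D b = w) \<or> (w \<notin> verts D \<and> b = f)"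
    using out_arc[OF deg] by (auto simp: a_def b_def out_arc_def)
  have ab: "v \<noteq> w \<Longrightarrow> a \<noteq> b" using a b f by auto
  have n: "subdivided D v w f f' x = (let y = (if x = f' then a else if nxt D x = a then f' else nxt D x);
      q = (if v = w then f' else b) in if x = f then q else if y = q then f else y)" for x
    by (auto simp: subdivided_def insert_before_def a_def[symmetric] b_def[symmetric])
  let ?m = "swap_images (subdivided D v w f f') f f' e"
  have "?m \<in> arcs E \<and> tail E ?m = head E e"
  proof -
    consider "e = f" | "e = f'" | "e \<in> arcs D" "e \<noteq> f" "e \<noteq> f'"
      using assms f unfolding E_arcs by auto
    then show ?thesis
    proof cases
      case 1
      then show ?thesis using a b ab f fr
        by (auto simp: swap_images_def n Let_def E_arcs E_tail E_head S_tail fresh_split_def)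
    next
      case 2
      then show ?thesis using a b ab f fr
        by (auto simp: swap_images_def n Let_def E_arcs E_tail E_head S_tail fresh_split_def)
    next
      case 3
      note x = nxt[OF ac 3(1)]
      have xV: "tail D (nxt D e) \<in> verts D" using x 3(1) by simp
      have xa: "nxt D e = a \<longleftrightarrow> v = head D e" and xb: "nxt D e = b \<longleftrightarrow> w = head D e"
        using x xV a b f deg_oneD(1)[OF deg] by metis+
      have xf: "nxt D e \<noteq> f" "nxt D e \<noteq> f'" using x f by auto
      moreover have "b \<noteq> f'" "a \<noteq> f" using a b f by auto
      ultimately show ?thesis using 3 x xa xb f fr ab
        by (auto simp: swap_images_def n Let_def E_arcs E_tail E_head S_tail S_head fresh_split_def)
    qed
  qed
  then show ?thesis using E_deg by (intro nxt_eq) (auto simp: deg_one_def bij_betw_def)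
qed

lemma same_component_iff_orbit:
  "same_component D v w \<longleftrightarrow> (f, f') \<notin> (steps (nxt E) (arcs E))\<^sup>*"
proof -
  have "steps (nxt E) (arcs E) = steps (swap_images (subdivided D v w f f') f f') (arcs E)"
    using nxt_cut by (rule steps_cong)
  then show ?thesis
    using same_component_iff_subdivided[OF fin deg f, of v w] f E_fin
      orbit_swap_images[OF _ subdivided_bij[OF fin deg f], of f f' v w]
    by (simp add: E_arcs)
qed

lemma cut_orbit_sym: "(x, y) \<in> (steps (nxt E) (arcs E))\<^sup>* \<Longrightarrow> (y, x) \<in> (steps (nxt E) (arcs E))\<^sup>*"
  using orbit_sym[OF _ bij_nxt[OF cut_arc_cycles]] cut_arc_cycles by (auto simp: arc_cycles_def)

lemma cut_closed_in_split:
  assumes "closed_in E U"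
  shows "closed_in S U"
  unfolding closed_in_def S_arcs
proof
  fix e assume "e \<in> arcs D"
  then have "e \<in> arcs E" "e \<noteq> f" "e \<noteq> f'" using f by (auto simp: E_arcs)
  then show "tail S e \<in> U \<longleftrightarrow> head S e \<in> U"
    using assms unfolding closed_in_def by (metis E_tail E_head)
qed

text \<open>Since \<open>S\<close> lacks the new arcs, the tails of an orbit in \<open>E\<close> are
  closed in \<open>S\<close> as well, and therefore contain the component in \<open>S\<close> of
  either end of \<open>e\<close>.\<close>

lemma cut_component_orbit:
  assumes "e \<in> arcs E" "x \<in> verts S" "x = tail E e \<or> x = head E e" "e' \<in> arcs E" "tail E e' \<in> component S x"
  shows "(e, e') \<in> (steps (nxt E) (arcs E))\<^sup>*"
proof -
  let ?O = "(steps (nxt E) (arcs E))\<^sup>* `` {e}"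
  have cl: "closed_in E (tail E ` ?O)" by (rule closed_in_tails_orbit[OF cut_arc_cycles assms(1)])
  have "tail E e \<in> tail E ` ?O" by auto
  then have "x \<in> tail E ` ?O" using assms(1,3) cl by (auto simp: closed_in_def)
  then have "component S x \<subseteq> tail E ` ?O"
    by (intro component_least[OF S_wf assms(2) cut_closed_in_split[OF cl]])
  then obtain e2 where e2: "e2 \<in> ?O" "tail E e2 = tail E e'" using assms(5) by (metis imageE subsetD)
  have "e2 \<in> arcs E" using orbit_image(1)[OF _ bij_nxt[OF cut_arc_cycles] assms(1)] cut_arc_cycles e2(1)
    by (auto simp: arc_cycles_def)
  then show ?thesis using e2 assms(4) deg_oneD(1)[OF E_deg] by blast
qed

lemma cut_fresh: 
  assumes "same_component D v w" "K \<subseteq> other_components D v w"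
  shows "v2 \<notin> \<Union>K" "w2 \<notin> \<Union>K"
proof -
  have "\<Union>K \<subseteq> verts D \<union> {v, w}"
    using assms(2) component_sub[of "add_points D v w"]
    by (fastforce simp: other_components_def components_def add_points_def)
  then show "v2 \<notin> \<Union>K" "w2 \<notin> \<Union>K" using fr by (auto simp: fresh_split_def)
qed

lemma cut_new_arcs: "f \<in> arcs E" "f' \<in> arcs E" "tail E f = w2" "tail E f' = v2" "head E f = v1" "head E f' = w1"
  using f by (auto simp: E_arcs E_tail E_head)

private lemma v12_in: "v1 \<in> verts S" "v2 \<in> verts S" by (auto simp: S_verts)

text \<open>Move (b) discards the whole cycle of \<open>f'\<close>: it runs through the fresh vertex
  \<open>v2\<close>, which could belong to the component of \<open>v1\<close> only if both new arcs
  shared a cycle.\<close>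

lemma cut_restrict_b:
  assumes "same_component D v w" "K \<subseteq> other_components D v w" "e \<in> arcs (E \<restriction> (\<Union>K \<union> component S v1))"
  shows "(f', e) \<notin> (steps (nxt E) (arcs E))\<^sup>*"
proof
  assume "(f', e) \<in> (steps (nxt E) (arcs E))\<^sup>*"
  then have "(e, f') \<in> (steps (nxt E) (arcs E))\<^sup>*" by (rule cut_orbit_sym)
  moreover have "closed_in E (\<Union>K \<union> component S v1)"
    by (rule closed_un[OF K_closed(1)[OF assms(1,2)] P_closed[OF assms(1)]])
  ultimately have "v2 \<in> \<Union>K \<union> component S v1"
    using orbit_closed_in[OF cut_arc_cycles, of _ e f'] assms(3) cut_new_arcs by (auto simp: arcs_induce)
  then have "v2 \<in> component S v1" using cut_fresh[OF assms(1,2)] by auto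
  then have "(f, f') \<in> (steps (nxt E) (arcs E))\<^sup>*"
    using cut_new_arcs v12_in by (intro cut_component_orbit) auto
  then show False using same_component_iff_orbit assms(1) by simp
qed

lemma cut_restrict_c:
  assumes "same_component D v w" "K \<subseteq> other_components D v w" "e \<in> arcs (E \<restriction> (\<Union>K \<union> component S v2))"
  shows "(f, e) \<notin> (steps (nxt E) (arcs E))\<^sup>*"
proof
  assume "(f, e) \<in> (steps (nxt E) (arcs E))\<^sup>*"
  then have "(e, f) \<in> (steps (nxt E) (arcs E))\<^sup>*" by (rule cut_orbit_sym)
  moreover have "closed_in E (\<Union>K \<union> component S v2)"
    by (rule closed_un[OF K_closed(1)[OF assms(1,2)] P'_closed[OF assms(1)]])
  ultimately have "w2 \<in> \<Union>K \<union> component S v2"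
    using orbit_closed_in[OF cut_arc_cycles, of _ e f] assms(3) cut_new_arcs by (auto simp: arcs_induce)
  then have "w2 \<in> component S v2" using cut_fresh[OF assms(1,2)] by auto
  then have "(f', f) \<in> (steps (nxt E) (arcs E))\<^sup>*"
    using cut_new_arcs v12_in by (intro cut_component_orbit) auto
  then show False using same_component_iff_orbit assms(1) cut_orbit_sym by simp
qed

text \<open>Putting \<open>v\<close> and \<open>w\<close> back into the two paths gives a set closed
  in the digraph before the cut, which therefore contains the component of \<open>v\<close>.\<close>

lemma cut_cover:
  assumes "same_component D v w"
  shows "verts E \<subseteq> \<Union>(other_components D v w) \<union> component S v1 \<union> component S v2"
proof
  let ?P = "component S v1" and ?P' = "component S v2" and ?D = "add_points D v w"
  have D: "verts ?D = verts D \<union> {v, w}" "arcs ?D = arcs D" "tail ?D = tail D" "head ?D = head D"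
    by (auto simp: add_points_def)
  have wf: "wf_digraph ?D" by unfold_locales (auto simp: D)
  have cl: "closed_in E ?P" "closed_in E ?P'" using P_closed P'_closed assms by auto
  have v: "v1 \<in> ?P" "v2 \<in> ?P'" using v12_in by (auto intro: component_self)
  then have w: "w2 \<in> ?P" "w1 \<in> ?P'" using cl cut_new_arcs unfolding closed_in_def by metis+
  let ?U = "(?P \<union> ?P') \<union> {v, w}"
  have fresh: "tail D e \<notin> {v1, v2, w1, w2}" "head D e \<notin> {v1, v2, w1, w2}" if "e \<in> arcs D" for e
    using fr that tail_in_verts[OF that] head_in_verts[OF that] by (auto simp: fresh_split_def)
  have PV: "?P \<union> ?P' \<subseteq> verts S" using component_sub[of S] by simp
  have vw: "v \<notin> ?P \<union> ?P'" "w \<notin> ?P \<union> ?P'" using PV fr by (auto simp: S_verts fresh_split_def)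
  have cS: "closed_in S (?P \<union> ?P')" using cut_closed_in_split closed_un cl by blast
  have "closed_in ?D ?U" unfolding closed_in_def D
  proof
    fix e assume e: "e \<in> arcs D"
    have "tail S e \<in> ?P \<union> ?P' \<longleftrightarrow> head S e \<in> ?P \<union> ?P'" using cS e by (auto simp: closed_in_def S_arcs)
    moreover have "tail S e \<in> ?P \<union> ?P' \<longleftrightarrow> tail D e \<in> ?U"
      using v w by (auto simp: S_tail[OF e])
    moreover have "head S e \<in> ?P \<union> ?P' \<longleftrightarrow> head D e \<in> ?U"
      using v w by (auto simp: S_head[OF e])
    ultimately show "tail D e \<in> ?U \<longleftrightarrow> head D e \<in> ?U" by simp
  qed
  then have sub: "component ?D v \<subseteq> ?U" by (intro component_least[OF wf]) (auto simp: D)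
  fix x assume x: "x \<in> verts E"
  show "x \<in> \<Union>(other_components D v w) \<union> ?P \<union> ?P'"
  proof (cases "x \<in> {v1, v2, w1, w2}")
    case True
    then show ?thesis using v w by auto
  next
    case False
    then have xD: "x \<in> verts D" "x \<noteq> v" "x \<noteq> w" using x by (auto simp: E_verts)
    then have xc: "x \<in> component ?D x" by (intro component_self) (auto simp: D)
    show ?thesis
    proof (cases "component ?D x = component ?D v")
      case True
      then show ?thesis using xc sub xD by auto
    next
      case False
      then have "component ?D x \<in> other_components D v w"
        using xD by (auto simp: other_components_def components_def D)
      then show ?thesis using xc by auto
    qed
  qed
qed

lemma cut_keep_a:
  assumes "same_component D v w"
  shows "arcs (E \<restriction> (\<Union>(other_components D v w) \<union> component S v1 \<union> component S v2)) = arcs E"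
proof -
  interpret E: fin_digraph E by (rule E_fin)
  let ?U = "\<Union>(other_components D v w) \<union> component S v1 \<union> component S v2"
  have "tail E e \<in> ?U" "head E e \<in> ?U" if "e \<in> arcs E" for e
    using that subsetD[OF cut_cover[OF assms]] E.tail_in_verts E.head_in_verts by metis+
  then show ?thesis unfolding arcs_induce by blast
qed

text \<open>Converse of \<open>cut_restrict_b\<close> for the full move: everything off the cycle of
  \<open>f'\<close> is kept, so the larger game retains all the images it has to.\<close>

lemma cut_keep_b:
  assumes "same_component D v w" "e \<in> arcs E" "(f', e) \<notin> (steps (nxt E) (arcs E))\<^sup>*"
  shows "e \<in> arcs (E \<restriction> (\<Union>(other_components D v w) \<union> component S v1))"
proof -
  let ?U = "\<Union>(other_components D v w) \<union> component S v1"
  have cl: "closed_in E ?U"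
    by (rule closed_un[OF K_closed(1)[OF assms(1)] P_closed[OF assms(1)]]) simp
  have "tail E e \<notin> component S v2"
    using cut_component_orbit[of f' v2 e] cut_new_arcs v12_in assms by auto
  moreover have "tail E e \<in> verts E" using assms(2) E_fin by (simp add: fin_digraph_def wf_digraph.tail_in_verts)
  ultimately have "tail E e \<in> ?U" using cut_cover[OF assms(1)] by auto
  then show ?thesis using cl assms(2) by (auto simp: arcs_induce closed_in_def)
qed

lemma cut_keep_c:
  assumes "same_component D v w" "e \<in> arcs E" "(f, e) \<notin> (steps (nxt E) (arcs E))\<^sup>*"
  shows "e \<in> arcs (E \<restriction> (\<Union>(other_components D v w) \<union> component S v2))"
proof -
  let ?U = "\<Union>(other_components D v w) \<union> component S v2"
  have cl: "closed_in E ?U"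
    by (rule closed_un[OF K_closed(1)[OF assms(1)] P'_closed[OF assms(1)]]) simp
  have "tail E e \<notin> component S v1"
    using cut_component_orbit[of f v1 e] cut_new_arcs v12_in assms by auto
  moreover have "tail E e \<in> verts E" using assms(2) E_fin by (simp add: fin_digraph_def wf_digraph.tail_in_verts)
  ultimately have "tail E e \<in> ?U" using cut_cover[OF assms(1)] by auto
  then show ?thesis using cl assms(2) by (auto simp: arcs_induce closed_in_def)
qed

end

section \<open>Translating the choice of Marker\<close>

text \<open>Both sides place \<open>f'\<close>, \<open>f\<close>, \<open>p\<close> in this order.
  This serves the crosswise matching, where the roles of the new arcs are interchanged.\<close>

lemma insert_before_exchange:
  assumes "f \<noteq> f'" "p \<noteq> f" "p \<noteq> f'" "x \<notin> {f, f'} \<Longrightarrow> n x \<notin> {f, f'}"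
  shows "insert_before (insert_before n p f') p f x = insert_before (insert_before n p f) f f' x"
  using assms by (auto simp: insert_before_def)

text \<open>The vertex \<open>u\<close> is fixed before \<open>d\<close> and \<open>d'\<close> are
  quantified, since Marker moves before Cutter names the new arcs. Only an actual vertex
  \<open>u'\<close> can land, and its out-arc does not depend on the default, so
  \<open>undefined\<close> may fill in.\<close>

lemma lands_obtain:
  fixes D :: "('v, 'e) pre_digraph" and D' :: "('u, 'f) pre_digraph"
  assumes "fin_digraph D" "deg_one D" "embeds (arcs D) (nxt D) (arcs D') n' \<iota>" "z \<notin> verts D"
  obtains u where "u \<in> insert z (verts D)"
    "\<And>d d'. d \<notin> arcs D \<Longrightarrow> d' \<notin> arcs D' \<Longrightarrow>
       lands (arcs D) (arcs D') n' \<iota> (out_arc D' u' d') (out_arc D u d) d"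
proof (cases "u' \<in> verts D' \<and>
    (\<exists>e \<in> arcs D. (out_arc D' u' undefined, \<iota> e) \<in> (steps n' (arcs D' - \<iota> ` arcs D))\<^sup>*)")
  case True
  then obtain e where u': "u' \<in> verts D'" and e: "e \<in> arcs D"
    "(out_arc D' u' undefined, \<iota> e) \<in> (steps n' (arcs D' - \<iota> ` arcs D))\<^sup>*" by auto
  have wf: "wf_digraph D" using assms(1) by (simp add: fin_digraph_def)
  have o: "out_arc D' u' d' = out_arc D' u' undefined" for d' using u' by (simp add: out_arc_def)
  have "lands (arcs D) (arcs D') n' \<iota> (out_arc D' u' d') (out_arc D (tail D e) d) d"
    if "d \<notin> arcs D" for d d'
    using e that out_arc_tail[OF wf assms(2) e(1)] o[of d'] by (auto simp: lands_def)
  moreover have "tail D e \<in> insert z (verts D)" using e wf by (simp add: wf_digraph.tail_in_verts)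
  ultimately show ?thesis using that by blast
next
  case False
  have "lands (arcs D) (arcs D') n' \<iota> (out_arc D' u' d') (out_arc D z d) d"
    if "d \<notin> arcs D" "d' \<notin> arcs D'" for d d'
  proof (cases "u' \<in> verts D'")
    case True
    then have "out_arc D' u' d' = out_arc D' u' undefined" by (simp add: out_arc_def)
    then show ?thesis using True False assms(4) by (auto simp: lands_def out_arc_notin)
  next
    case u': False
    have "(d', \<iota> e) \<notin> (steps n' (arcs D' - \<iota> ` arcs D))\<^sup>*" if "e \<in> arcs D" for e
    proof
      assume "(d', \<iota> e) \<in> (steps n' (arcs D' - \<iota> ` arcs D))\<^sup>*"
      from steps_terminal[OF this] have "\<iota> e = d'" using \<open>d' \<notin> arcs D'\<close> by auto
      then show False using that \<open>d' \<notin> arcs D'\<close> assms(3) by (auto simp: embeds_def)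
    qed
    then show ?thesis using u' assms(4) by (auto simp: lands_def out_arc_notin)
  qed
  then show ?thesis using that by blast
qed

text \<open>
  Marker's answer to the choice of \<open>v'\<close> and \<open>w'\<close> in the larger state: a vertex is replaced by the
  tail of the first arc of the smaller state that is met when walking from it, and by a dummy vertex
  if there is no such arc. If \<open>v'\<close> and \<open>w'\<close> are replaced by the same vertex,
  then their order on the cycle decides whether the two new arcs correspond to each other
  directly or crosswise.
\<close>

lemma subdivided_embeds:
  fixes D :: "('v, 'e) pre_digraph" and D' :: "('u, 'f) pre_digraph"
  assumes fin: "fin_digraph D" and deg: "deg_one D" and fin': "fin_digraph D'" and deg': "deg_one D'"
    and emb: "embeds (arcs D) (nxt D) (arcs D') (nxt D') \<iota>"
    and xy: "x \<noteq> y" "x \<notin> verts D" "y \<notin> verts D"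
  obtains (answer) v w where "v \<in> verts D \<union> {x, y}" "w \<in> verts D \<union> {x, y}"
    "\<And>f f' F F'. f \<notin> arcs D \<Longrightarrow> f' \<notin> arcs D \<Longrightarrow> f \<noteq> f' \<Longrightarrow>
       F \<notin> arcs D' \<Longrightarrow> F' \<notin> arcs D' \<Longrightarrow> F \<noteq> F' \<Longrightarrow>
       \<exists>\<kappa>. (\<forall>e \<in> arcs D. \<kappa> e = \<iota> e) \<and> (\<kappa> f = F \<and> \<kappa> f' = F' \<or> \<kappa> f = F' \<and> \<kappa> f' = F) \<and>
         embeds (insert f (insert f' (arcs D))) (subdivided D v w f f')
           (insert F (insert F' (arcs D'))) (subdivided D' v' w' F F') \<kappa>"
proof -
  let ?A = "arcs D" and ?A' = "arcs D'" and ?n = "nxt D" and ?n' = "nxt D'"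
  let ?B = "?A' - \<iota> ` ?A"
  let ?R = "(steps ?n' ?B)\<^sup>*"
  let ?good = "\<lambda>v w f f' F F'. \<exists>\<kappa>. (\<forall>e \<in> arcs D. \<kappa> e = \<iota> e) \<and>
         (\<kappa> f = F \<and> \<kappa> f' = F' \<or> \<kappa> f = F' \<and> \<kappa> f' = F) \<and>
         embeds (insert f (insert f' (arcs D))) (subdivided D v w f f')
           (insert F (insert F' (arcs D'))) (subdivided D' v' w' F F') \<kappa>"
  interpret D: fin_digraph D by fact
  interpret D': fin_digraph D' by fact
  have ac: "arc_cycles D" "arc_cycles D'" by (auto intro: arc_cyclesI fin deg fin' deg')
  have n: "\<And>e. e \<in> ?A \<Longrightarrow> ?n e \<in> ?A" "\<And>e. e \<in> ?A' \<Longrightarrow> ?n' e \<in> ?A'" using nxt(1) ac by metis+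
  have \<iota>: "inj_on \<iota> ?A" "\<iota> ` ?A \<subseteq> ?A'" using emb by (auto simp: embeds_def)
  have out: "out_arc D u d \<in> insert d ?A" for u d
    using out_arc(1)[OF deg] by (auto simp: out_arc_def)
  have out': "out_arc D' u d \<in> insert d ?A'" for u d
    using out_arc(1)[OF deg'] by (auto simp: out_arc_def)
  obtain v where v: "v \<in> insert x (verts D)"
    "\<And>d d'. d \<notin> ?A \<Longrightarrow> d' \<notin> ?A' \<Longrightarrow> lands ?A ?A' ?n' \<iota> (out_arc D' v' d') (out_arc D v d) d"
    using lands_obtain[OF fin deg emb xy(2)] by blast
  obtain w0 where w0: "w0 \<in> insert y (verts D)"
    "\<And>d d'. d \<notin> ?A \<Longrightarrow> d' \<notin> ?A' \<Longrightarrow> lands ?A ?A' ?n' \<iota> (out_arc D' w' d') (out_arc D w0 d) d"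
    using lands_obtain[OF fin deg emb xy(3)] by blast
  let ?N' = "\<lambda>F'. insert_before ?n' (out_arc D' v' F') F'"
  let ?q' = "\<lambda>F F'. if v' = w' then F' else out_arc D' w' F"
  \<comment> \<open>The arc \<open>f'\<close> is inserted first, so the landing of \<open>F\<close>
    has to be judged in the permutation that already contains \<open>F'\<close>.\<close>
  have step: "embeds (insert f (insert f' ?A)) (insert_before (insert_before ?n (out_arc D v f') f') q f)
       (insert F (insert F' ?A')) (subdivided D' v' w' F F') (\<iota>(f' := F', f := F))"
    if fr: "f \<notin> ?A" "f' \<notin> ?A" "f \<noteq> f'" "F \<notin> ?A'" "F' \<notin> ?A'" "F \<noteq> F'"
      and lands: "lands (insert f' ?A) (insert F' ?A') (?N' F') (\<iota>(f' := F')) (?q' F F') q f"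
    for f f' F F' q
    unfolding subdivided_def
  proof (rule embeds_insert)
    show "embeds (insert f' ?A) (insert_before ?n (out_arc D v f') f') (insert F' ?A') (?N' F') (\<iota>(f' := F'))"
      using fr v(2)[OF fr(2,5)]
      by (intro embeds_insert[OF emb n(1) _ bij_nxt[OF ac(2)] _ _ out']) auto
    show "insert_before ?n (out_arc D v f') f' e \<in> insert f' ?A" if "e \<in> insert f' ?A" for e
      using that n(1) out by (intro insert_before_in)
    show "bij_betw (?N' F') (insert F' ?A') (insert F' ?A')"
      using fr by (intro bij_insert_before bij_nxt ac out') auto
    show "?q' F F' \<in> insert F (insert F' ?A')" using out' by auto
    show "f \<notin> insert f' ?A" "F \<notin> insert F' ?A'" using fr by auto
  qed (use lands in auto)
  have diff: "insert F' ?A' - \<iota>(f' := F') ` insert f' ?A = ?B" if "f' \<notin> ?A" "F' \<notin> ?A'" for f' F'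
  proof -
    have "\<iota>(f' := F') ` insert f' ?A = insert F' (\<iota> ` ?A)" using that by auto
    then show ?thesis using that by auto
  qed
  have direct: "?good v w f f' F F'"
    if "f \<notin> ?A" "f' \<notin> ?A" "f \<noteq> f'" "F \<notin> ?A'" "F' \<notin> ?A'" "F \<noteq> F'"
      and "lands (insert f' ?A) (insert F' ?A') (?N' F') (\<iota>(f' := F')) (?q' F F')
        (if v = w then f' else out_arc D w f) f" for w f f' F F'
  proof (intro exI conjI)
    show "embeds (insert f (insert f' ?A)) (subdivided D v w f f')
        (insert F (insert F' ?A')) (subdivided D' v' w' F F') (\<iota>(f' := F', f := F))"
      using step[OF that] by (simp add: subdivided_def)
  qed (use that in auto)
  \<comment> \<open>If the walk belonging to \<open>F\<close> meets \<open>F'\<close> before any old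
    image arc, the right answer is \<open>v\<close> twice, with \<open>f\<close> directly before
    \<open>f'\<close>.\<close>
  have v_meet: "?good v v f f' F F'"
    if fr: "f \<notin> ?A" "f' \<notin> ?A" "f \<noteq> f'" "F \<notin> ?A'" "F' \<notin> ?A'" "F \<noteq> F'"
      and meet: "(?q' F F', F') \<in> (steps (?N' F') ?B)\<^sup>*" for f f' F F'
    by (rule direct[OF fr], unfold lands_def diff[OF fr(2,5)]) (use fr meet in simp)
  have conclude: thesis if "w \<in> verts D \<union> {x, y}"
    and good: "\<And>f f' F F'. f \<notin> ?A \<Longrightarrow> f' \<notin> ?A \<Longrightarrow> f \<noteq> f' \<Longrightarrow>
      F \<notin> ?A' \<Longrightarrow> F' \<notin> ?A' \<Longrightarrow> F \<noteq> F' \<Longrightarrow> ?good v w f f' F F'" for w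
  proof (rule answer[OF _ that(1)])
    show "v \<in> verts D \<union> {x, y}" using v(1) by auto
  qed (rule good)
  have vV: "v \<in> verts D \<union> {x, y}" using v(1) by auto
  show ?thesis
  proof (cases "v' = w'")
    case True
    show ?thesis
    proof (rule conclude[OF vV])
      show "?good v v f f' F F'"
        if fr: "f \<notin> ?A" "f' \<notin> ?A" "f \<noteq> f'" "F \<notin> ?A'" "F' \<notin> ?A'" "F \<noteq> F'" for f f' F F'
        by (rule v_meet[OF fr]) (simp add: True)
    qed
  next
    case v'w': False
    then have q': "?q' F F' = out_arc D' w' F" for F F' by simp
    have FB: "F \<notin> ?A' \<Longrightarrow> F \<notin> ?B" for F by simp
    show ?thesis
    proof (cases "w0 \<in> verts D")
      case True
      define b where "b = out_arc D w0 undefined"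
      have b: "b \<in> ?A" "tail D b = w0" "\<And>d. out_arc D w0 d = b"
        using out_arc[OF deg True] True by (auto simp: b_def out_arc_def)
      have land_b: "(out_arc D' w' F, \<iota> b) \<in> ?R" if "f \<notin> ?A" "F \<notin> ?A'" for f F
        using w0(2)[OF that] b(1,3) that(1) by (auto simp: lands_def split: if_splits)
      have good: "?good v w0 f f' F F'"
        if fr: "f \<notin> ?A" "f' \<notin> ?A" "f \<noteq> f'" "F \<notin> ?A'" "F' \<notin> ?A'" "F \<noteq> F'" for f f' F F'
      proof (cases "v = w0")
        case False
        have lv: "lands ?A ?A' ?n' \<iota> (out_arc D' v' F') (out_arc D v f') f'" by (rule v(2)) fact+
        \<comment> \<open>The walk from \<open>w'\<close> ends at \<open>\<iota> b\<close>. Had it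
          met the insertion point at \<open>v'\<close>, that point would land on \<open>b\<close>
          too, contrary to \<open>v \<noteq> w0\<close>; so inserting \<open>F'\<close> does not
          disturb it.\<close>
        have "(out_arc D' v' F', \<iota> b) \<notin> ?R"
        proof
          assume h: "(out_arc D' v' F', \<iota> b) \<in> ?R"
          then have a: "out_arc D v f' \<in> ?A" "(out_arc D' v' F', \<iota> (out_arc D v f')) \<in> ?R"
            using lv b(1) by (auto simp: lands_def split: if_splits)
          then have "\<iota> (out_arc D v f') = \<iota> b" using h b(1) by (intro steps_end_unique[OF a(2) h]) auto
          then have "out_arc D v f' = b" using a(1) b(1) \<iota>(1) by (auto dest: inj_onD)
          moreover have "v \<in> verts D" using a(1) fr by (auto simp: out_arc_def split: if_splits)
          ultimately show False using out_arc(2)[OF deg, of v f'] b(2) False by simp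
        qed
        note hit = insert_before_steps_avoid[OF FB[OF fr(5)] land_b[OF fr(1,4)] this]
        show ?thesis
          by (rule direct[OF fr], unfold lands_def diff[OF fr(2,5)]) (use fr b False q' hit in auto)
      next
        case vw0: True
        show ?thesis
        proof (cases "(out_arc D' w' F, F') \<in> (steps (?N' F') ?B)\<^sup>*")
          case True
          then show ?thesis using v_meet[OF fr] q' vw0 by simp
        next
          case False
          then have hit: "(out_arc D' w' F, \<iota> b) \<in> (steps (?N' F') ?B)\<^sup>*"
            using insert_before_steps_meet[OF FB[OF fr(5)] land_b[OF fr(1,4)]] by metis
          \<comment> \<open>Here \<open>F'\<close> precedes \<open>F\<close> on the way to the
            common landing arc, whereas \<open>subdivided\<close> at equal vertices always places
            \<open>f\<close> before \<open>f'\<close>. Hence \<open>f\<close> is matched with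
            \<open>F'\<close> and \<open>f'\<close> with \<open>F\<close>.\<close>
          have emb': "embeds (insert f (insert f' ?A)) (insert_before (insert_before ?n (out_arc D v f) f) b f')
             (insert F (insert F' ?A')) (subdivided D' v' w' F F') (\<iota>(f := F', f' := F))"
            unfolding insert_commute[of f f' ?A]
            by (rule step[OF fr(2,1) fr(3)[symmetric] fr(4-6)], unfold lands_def diff[OF fr(1,5)])
              (use fr b hit q' in auto)
          have eq: "insert_before (insert_before ?n (out_arc D v f) f) b f' e = subdivided D v w0 f f' e"
            if e: "e \<in> insert f (insert f' ?A)" for e
          proof -
            have "insert_before (insert_before ?n b f) b f' e = insert_before (insert_before ?n b f') f' f e"
              using fr(1-3) b(1) e n(1)[of e] by (intro insert_before_exchange) auto
            then show ?thesis by (simp add: subdivided_def vw0 b(3))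
          qed
          from emb' have "embeds (insert f (insert f' ?A)) (subdivided D v w0 f f')
             (insert F (insert F' ?A')) (subdivided D' v' w' F F') (\<iota>(f := F', f' := F))"
            by (rule iffD1[OF embeds_cong, rotated 2]) (erule eq, rule refl)
          then show ?thesis using fr by (intro exI[of _ "\<iota>(f := F', f' := F)"]) auto
        qed
      qed
      show ?thesis by (rule conclude[OF _ good]) (use w0(1) in auto)
    next
      case False
      then have w0y: "w0 = y" using w0(1) by simp
      have miss: "(out_arc D' w' F, \<iota> e) \<notin> ?R" if "f \<notin> ?A" "F \<notin> ?A'" "e \<in> ?A" for f F e
        using w0(2)[OF that(1,2)] that(3) False by (auto simp: lands_def out_arc_notin)
      show ?thesis
      proof (cases "w' \<in> verts D' \<and> v' \<in> verts D' \<and>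
          (out_arc D' w' undefined, out_arc D' v' undefined) \<in> ?R")
        case True
        then have o: "out_arc D' w' d = out_arc D' w' undefined" "out_arc D' v' d = out_arc D' v' undefined" for d
          by (auto simp: out_arc_def)
        \<comment> \<open>The walk from \<open>w'\<close> leads to \<open>v'\<close> and never meets
          the image, so \<open>v'\<close> lands nowhere either. Both lie on one cycle and must
          therefore be replaced by the same dummy vertex.\<close>
        have good: "?good v v f f' F F'"
          if fr: "f \<notin> ?A" "f' \<notin> ?A" "f \<noteq> f'" "F \<notin> ?A'" "F' \<notin> ?A'" "F \<noteq> F'" for f f' F F'
        proof (rule v_meet[OF fr])
          have "out_arc D' w' F \<noteq> out_arc D' v' F'"
            using out_arc(2)[OF deg'] True v'w' by metis
          then show "(?q' F F', F') \<in> (steps (?N' F') ?B)\<^sup>*"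
            unfolding q' using True o by (intro insert_before_steps_hit[OF FB[OF fr(5)]]) metis+
        qed
        show ?thesis by (rule conclude[OF _ good]) (use v(1) in auto)
      next
        case sep: False
        \<comment> \<open>The walk from \<open>w'\<close> meets neither the image nor
          \<open>F'\<close>, so \<open>f\<close> has to become a loop apart from \<open>v\<close>.
          The second dummy vertex achieves this even if \<open>v\<close> is the first.\<close>
        have good: "?good v y f f' F F'"
          if fr: "f \<notin> ?A" "f' \<notin> ?A" "f \<noteq> f'" "F \<notin> ?A'" "F' \<notin> ?A'" "F \<noteq> F'" for f f' F F'
        proof (rule direct[OF fr])
          let ?b' = "out_arc D' w' F" and ?a' = "out_arc D' v' F'"
          have stay: "z \<in> ?A'" if "(?b', z) \<in> ?R" "w' \<in> verts D'" for z
            using that(1) by (rule steps_invariant) (use out_arc(1)[OF deg' that(2)] n(2) in auto)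
          have stop: "z = F" if "(?b', z) \<in> ?R" "w' \<notin> verts D'" for z
            using that fr(4) out_arc_notin[OF that(2)] steps_terminal[OF that(1)] by auto
          have "(?b', ?a') \<notin> ?R"
          proof
            assume h: "(?b', ?a') \<in> ?R"
            have "w' \<in> verts D'" using stop[OF h] out'[of v' F'] fr by auto
            moreover from this have "v' \<in> verts D'" using stay[OF h] fr out_arc_notin[of v' D' F'] by metis
            ultimately show False using sep h by (auto simp: out_arc_def)
          qed
          note conv = insert_before_steps_conv[OF FB[OF fr(5)] _ this]
          have "(?b', F') \<notin> ?R" using stop[of F'] stay[of F'] fr by auto
          then have "(?b', (\<iota>(f' := F')) e) \<notin> (steps (?N' F') ?B)\<^sup>*" if "e \<in> insert f' ?A" for e
            using that conv miss[OF fr(1,4), of e] fr by auto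
          moreover have "v \<noteq> y" using v(1) xy by auto
          ultimately show "lands (insert f' ?A) (insert F' ?A') (?N' F') (\<iota>(f' := F')) (?q' F F')
              (if v = y then f' else out_arc D y f) f"
            unfolding lands_def q' diff[OF fr(2,5)] using out_arc_notin[OF xy(3)] by simp
        qed
        show ?thesis by (rule conclude[OF _ good]) (use v(1) in auto)
      qed
    qed
  qed
qed

section \<open>Minors of game states\<close>

text \<open>The label condition makes the label of \<open>e\<close> a function of that of
  \<open>\<iota> e\<close>, whence the value cannot grow on passing to a minor.\<close>

definition minor_state :: "('v, 'e, 'l) config \<Rightarrow> ('v, 'e, 'l) config \<Rightarrow> bool" where
  "minor_state = (\<lambda>(D, \<chi>, g) (D', \<chi>', g'). g \<le> g' \<and>
     (\<exists>\<iota>. embeds (arcs D) (nxt D) (arcs D') (nxt D') \<iota> \<and>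
       (\<forall>e \<in> arcs D. \<forall>e' \<in> arcs D. \<chi>' (\<iota> e) = \<chi>' (\<iota> e') \<longrightarrow> \<chi> e = \<chi> e')))"

lemma minor_state_iff:
  "minor_state (D, \<chi>, g) (D', \<chi>', g') \<longleftrightarrow> g \<le> g' \<and>
     (\<exists>\<iota>. embeds (arcs D) (nxt D) (arcs D') (nxt D') \<iota> \<and>
       (\<forall>e \<in> arcs D. \<forall>e' \<in> arcs D. \<chi>' (\<iota> e) = \<chi>' (\<iota> e') \<longrightarrow> \<chi> e = \<chi> e'))"
  by (simp add: minor_state_def)

lemma minor_state_refl: "minor_state s s"
  by (cases s) (auto simp: minor_state_def embeds_def intro!: exI[of _ id])

lemma minor_state_trans:
  assumes "minor_state s1 s2" "minor_state s2 s3"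
  shows "minor_state s1 s3"
proof -
  obtain D1 \<chi>1 g1 D2 \<chi>2 g2 D3 \<chi>3 g3 where s: "s1 = (D1, \<chi>1, g1)" "s2 = (D2, \<chi>2, g2)" "s3 = (D3, \<chi>3, g3)"
    by (metis prod.exhaust)
  obtain \<iota> \<kappa> where \<iota>: "embeds (arcs D1) (nxt D1) (arcs D2) (nxt D2) \<iota>"
      "\<And>e e'. e \<in> arcs D1 \<Longrightarrow> e' \<in> arcs D1 \<Longrightarrow> \<chi>2 (\<iota> e) = \<chi>2 (\<iota> e') \<Longrightarrow> \<chi>1 e = \<chi>1 e'"
    and \<kappa>: "embeds (arcs D2) (nxt D2) (arcs D3) (nxt D3) \<kappa>"
      "\<And>e e'. e \<in> arcs D2 \<Longrightarrow> e' \<in> arcs D2 \<Longrightarrow> \<chi>3 (\<kappa> e) = \<chi>3 (\<kappa> e') \<Longrightarrow> \<chi>2 e = \<chi>2 e'"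
    using assms(1)[unfolded s minor_state_iff] assms(2)[unfolded s minor_state_iff] by blast
  have \<iota>in: "\<iota> e \<in> arcs D2" if "e \<in> arcs D1" for e using \<iota>(1) that by (auto simp: embeds_def)
  have "\<chi>1 e = \<chi>1 e'" if "e \<in> arcs D1" "e' \<in> arcs D1" "\<chi>3 ((\<kappa> \<circ> \<iota>) e) = \<chi>3 ((\<kappa> \<circ> \<iota>) e')" for e e'
    using that(3) by (intro \<iota>(2)[OF that(1,2) \<kappa>(2)] \<iota>in that(1,2)) simp
  moreover have "g1 \<le> g3" using assms by (simp add: s minor_state_iff)
  ultimately show ?thesis using embeds_trans[OF \<iota>(1) \<kappa>(1)] unfolding s minor_state_iff by blast
qed

lemma minor_state_value:
  assumes "minor_state (D, \<chi>, g) (D', \<chi>', g')" "finite (arcs D')"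
  shows "state_value (D, \<chi>, g) \<le> state_value (D', \<chi>', g')"
proof -
  obtain \<iota> where emb: "embeds (arcs D) (nxt D) (arcs D') (nxt D') \<iota>"
    and lab: "\<And>e e'. e \<in> arcs D \<Longrightarrow> e' \<in> arcs D \<Longrightarrow> \<chi>' (\<iota> e) = \<chi>' (\<iota> e') \<Longrightarrow> \<chi> e = \<chi> e'"
    using assms(1)[unfolded minor_state_iff] by blast
  have sub: "\<iota> ` arcs D \<subseteq> arcs D'" using emb by (simp add: embeds_def)
  let ?L = "\<lambda>l. \<chi> (SOME e. e \<in> arcs D \<and> \<chi>' (\<iota> e) = l)"
  have "\<chi> e = ?L (\<chi>' (\<iota> e))" if "e \<in> arcs D" for e
  proof -
    let ?e = "SOME e'. e' \<in> arcs D \<and> \<chi>' (\<iota> e') = \<chi>' (\<iota> e)"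
    have "?e \<in> arcs D \<and> \<chi>' (\<iota> ?e) = \<chi>' (\<iota> e)"
      by (rule someI_ex) (use that in blast)
    then show ?thesis using lab[of ?e e] that by simp
  qed
  then have "\<chi> ` arcs D \<subseteq> ?L ` (\<chi>' ` arcs D')" using sub by blast
  then have "card (\<chi> ` arcs D) \<le> card (\<chi>' ` arcs D')"
    using assms(2) by (meson card_image_le card_mono dual_order.trans finite_imageI)
  then show ?thesis by (simp add: state_value_def)
qed

lemma equivalent_minor_state:
  assumes "equivalent (D, \<chi>, g) (D', \<chi>', g')" "arc_cycles D"
  shows "minor_state (D, \<chi>, g) (D', \<chi>', g')"
proof -
  obtain \<psi> \<phi> where \<psi>: "pre_digraph.digraph_isomorphism D \<psi>" "D' = app_iso \<psi> D"
    and \<phi>: "bij_betw \<phi> (\<chi> ` arcs D) (\<chi>' ` arcs D')" "\<And>e. e \<in> arcs D \<Longrightarrow> \<chi>' (iso_arcs \<psi> e) = \<phi> (\<chi> e)"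
    and g: "g = g'"
    using assms(1) by (auto simp: equivalent_def)
  have iso: "wf_digraph D" "inj_on (iso_verts \<psi>) (verts D)" "inj_on (iso_arcs \<psi>) (arcs D)"
    "\<And>e. e \<in> arcs D \<Longrightarrow> iso_tail \<psi> (iso_arcs \<psi> e) = iso_verts \<psi> (tail D e)"
    "\<And>e. e \<in> arcs D \<Longrightarrow> iso_head \<psi> (iso_arcs \<psi> e) = iso_verts \<psi> (head D e)"
    using \<psi>(1) by (auto simp: pre_digraph.digraph_isomorphism_def)
  have "tail D e \<in> verts D" if "e \<in> arcs D" for e using iso(1) that by (rule wf_digraph.tail_in_verts)
  then have "e = e'" if "e \<in> arcs D" "e' \<in> arcs D" "iso_verts \<psi> (tail D e) = iso_verts \<psi> (tail D e')" for e e'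
    using that iso(2) assms(2) unfolding arc_cycles_def by (metis inj_onD)
  then have "inj_on (tail D') (arcs D')" by (auto simp: \<psi>(2) inj_on_def iso(4))
  then have nxt': "nxt D' (iso_arcs \<psi> e) = iso_arcs \<psi> (nxt D e)" if "e \<in> arcs D" for e
    using nxt[OF assms(2) that] that by (intro nxt_eq) (auto simp: \<psi>(2) iso(4,5))
  have "embeds (arcs D) (nxt D) (arcs D') (nxt D') (iso_arcs \<psi>)"
    using iso(3) nxt' by (auto simp: embeds_def \<psi>(2))
  moreover have "\<chi> e = \<chi> e'" if "e \<in> arcs D" "e' \<in> arcs D" "\<chi>' (iso_arcs \<psi> e) = \<chi>' (iso_arcs \<psi> e')" for e e'
    using that \<phi> by (auto simp: bij_betw_def dest: inj_onD)
  ultimately show ?thesis unfolding minor_state_iff using g by blast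
qed

text \<open>Contraction deletes \<open>e\<close> from the cyclic order: its predecessor, if
  different from \<open>e\<close>, skips to the successor of \<open>e\<close>, as \<open>m\<close>
  describes, and the connecting walk consists of \<open>e\<close> alone.\<close>

lemma contract_edge_embeds:
  assumes ac: "arc_cycles D" and e: "e \<in> arcs D"
  defines "C \<equiv> contract_edge D e"
  shows "arc_cycles C" "embeds (arcs C) (nxt C) (arcs D) (nxt D) id"
proof -
  let ?r = "\<lambda>x. if x = head D e then tail D e else x"
  have C: "arcs C = arcs D - {e}" "\<And>a. tail C a = ?r (tail D a)" "\<And>a. head C a = ?r (head D a)"
    by (auto simp: C_def contract_edge_def Let_def)
  have inj: "inj_on (tail D) (arcs D)" "inj_on (head D) (arcs D)" and fin: "finite (arcs D)"
    using ac by (auto simp: arc_cycles_def)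
  have tail_ne: "tail D a \<noteq> tail D e" and head_ne: "head D a \<noteq> head D e" if "a \<in> arcs C" for a
    using that inj e by (auto simp: C dest: inj_onD)
  have CD: "a \<in> arcs D" if "a \<in> arcs C" for a using that by (simp add: C(1))
  have injC: "inj_on (tail C) (arcs C)" "inj_on (head C) (arcs C)"
  proof -
    show "inj_on (tail C) (arcs C)"
    proof (rule inj_onI)
      fix a b assume ab: "a \<in> arcs C" "b \<in> arcs C" "tail C a = tail C b"
      then have "tail D a = tail D b"
        using tail_ne[OF ab(1)] tail_ne[OF ab(2)] by (simp add: C(2) split: if_splits)
      then show "a = b" by (rule inj_onD[OF inj(1) _ CD[OF ab(1)] CD[OF ab(2)]])
    qed
    show "inj_on (head C) (arcs C)"
    proof (rule inj_onI)
      fix a b assume ab: "a \<in> arcs C" "b \<in> arcs C" "head C a = head C b"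
      then have "head D a = head D b"
        using head_ne[OF ab(1)] head_ne[OF ab(2)] by (simp add: C(3))
      then show "a = b" by (rule inj_onD[OF inj(2) _ CD[OF ab(1)] CD[OF ab(2)]])
    qed
  qed
  define m where "m a = (if nxt D a = e then nxt D e else nxt D a)" for a
  have m: "m a \<in> arcs C" "tail C (m a) = head C a" if a: "a \<in> arcs C" for a
  proof -
    have aD: "a \<in> arcs D" "a \<noteq> e" using a by (auto simp: C)
    have "nxt D e \<noteq> e" if "nxt D a = e"
      using that aD e bij_nxt[OF ac] by (metis bij_betw_def inj_onD)
    then show "m a \<in> arcs C" using nxt(1)[OF ac] aD e by (auto simp: m_def C)
    show "tail C (m a) = head C a"
      using nxt(2)[OF ac aD(1)] nxt(2)[OF ac e] head_ne[OF a] by (auto simp: m_def C)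
  qed
  have "head C ` arcs C = tail C ` arcs C"
  proof (rule card_subset_eq)
    show "finite (tail C ` arcs C)" using fin by (simp add: C)
    show "head C ` arcs C \<subseteq> tail C ` arcs C" using m by (metis image_eqI image_subsetI)
    show "card (head C ` arcs C) = card (tail C ` arcs C)" using injC by (simp add: card_image)
  qed
  then show "arc_cycles C" using injC fin by (simp add: arc_cycles_def C(1))
  have "nxt C a = m a" if "a \<in> arcs C" for a using m[OF that] injC(1) by (intro nxt_eq)
  moreover have "(nxt D a, m a) \<in> (steps (nxt D) (arcs D - id ` arcs C))\<^sup>*" for a
    using e by (auto simp: m_def C steps_iff)
  ultimately show "embeds (arcs C) (nxt C) (arcs D) (nxt D) id"
    by (auto simp: embeds_def C(1))
qed

lemma contractions_embed:
  assumes "contraction\<^sup>*\<^sup>* D D'" "arc_cycles D"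
  shows "arc_cycles D'" "embeds (arcs D') (nxt D') (arcs D) (nxt D) id"
proof -
  have "arc_cycles D' \<and> embeds (arcs D') (nxt D') (arcs D) (nxt D) id"
    using assms(1)
  proof (induction rule: rtranclp_induct)
    case base
    then show ?case using assms(2) by (auto simp: embeds_def)
  next
    case (step D1 D2)
    then obtain e where e: "e \<in> arcs D1" "D2 = contract_edge D1 e" by (auto simp: contraction_def)
    have D1: "arc_cycles D1" "embeds (arcs D1) (nxt D1) (arcs D) (nxt D) id" using conjunct1[OF step.IH] conjunct2[OF step.IH] .
    note D2 = contract_edge_embeds[OF D1(1) e(1), folded e(2)]
    show ?case using D2(1) embeds_trans[OF D2(2) D1(2)] unfolding comp_id by (rule conjI)
  qed
  then show "arc_cycles D'" "embeds (arcs D') (nxt D') (arcs D) (nxt D) id" by auto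
qed

lemma equivalent_reduction_minor_state:
  assumes "equivalent s r" "reduction r s0" "game_state s" "game_state s0"
  shows "minor_state s s0"
proof -
  obtain D \<chi> g Dr \<chi>r gr D0 \<chi>0 g0 where s: "s = (D, \<chi>, g)" "r = (Dr, \<chi>r, gr)" "s0 = (D0, \<chi>0, g0)"
    by (metis prod.exhaust)
  have ac: "arc_cycles D" "arc_cycles D0"
    using assms(3,4) by (auto simp: s game_state_def boundary_cycles_conv arc_cyclesI)
  have "minor_state s r" using equivalent_minor_state assms(1) ac unfolding s by metis
  moreover have "minor_state r s0"
    using assms(2) contractions_embed(2)[OF _ ac(2), of Dr]
    by (auto simp: s reduction_def minor_state_def intro!: exI[of _ id])
  ultimately show ?thesis by (rule minor_state_trans)
qed

text \<open>The sets \<open>U\<close> and \<open>U'\<close> need not correspond, only kept arcs must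
  have kept images. Closedness of \<open>U'\<close> holds the connecting walks inside it.\<close>

lemma minor_state_restrict:
  assumes "embeds (arcs E) (nxt E) (arcs E') (nxt E') \<kappa>"
    and "\<And>e e'. e \<in> arcs E \<Longrightarrow> e' \<in> arcs E \<Longrightarrow> \<chi>' (\<kappa> e) = \<chi>' (\<kappa> e') \<Longrightarrow> \<chi> e = \<chi> e'"
    and "arc_cycles E" "arc_cycles E'" "closed_in E U" "closed_in E' U'" "g \<le> g'"
    and "\<And>e. e \<in> arcs (E \<restriction> U) \<Longrightarrow> \<kappa> e \<in> arcs (E' \<restriction> U')"
  shows "minor_state (E \<restriction> U, \<chi>, g) (E' \<restriction> U', \<chi>', g')"
proof -
  note n = nxt_restrict[OF assms(3,5)] and n' = nxt_restrict[OF assms(4,6)]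
  have sub: "arcs (E \<restriction> U) \<subseteq> arcs E" "arcs (E' \<restriction> U') \<subseteq> arcs E'" by (auto simp: arcs_induce)
  have "embeds (arcs (E \<restriction> U)) (nxt E) (arcs (E' \<restriction> U')) (nxt E') \<kappa>"
    by (rule embeds_restrict[OF assms(1) sub]) (use assms(8) n'(2) in auto)
  then have "embeds (arcs (E \<restriction> U)) (nxt (E \<restriction> U)) (arcs (E' \<restriction> U')) (nxt (E' \<restriction> U')) \<kappa>"
    by (rule iffD1[OF embeds_cong, rotated 2]) (erule n(1)[symmetric], erule n'(1)[symmetric])
  then show ?thesis unfolding minor_state_iff using assms(2,7) sub(1) by blast
qed

section \<open>The simulation\<close>

lemma marker_simulates:
  fixes D D' :: "('v::infinite, 'e::infinite) pre_digraph" and \<chi> \<chi>' :: "'e \<Rightarrow> 'l::infinite"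
  assumes gs: "game_state (D, \<chi>, g)" "game_state (D', \<chi>', g')"
    and minor: "minor_state (D, \<chi>, g) (D', \<chi>', g')"
  obtains m where "m \<in> marker_choices (D, \<chi>, g)"
    "\<And>K h s. cutter_turn (D, \<chi>, g) m K h s \<Longrightarrow>
       \<exists>s'. cutter_turn (D', \<chi>', g') m' (other_components D' (fst m') (snd m')) g' s' \<and> minor_state s s'"
proof -
  have D: "fin_digraph D" "deg_one D" and D': "fin_digraph D'" "deg_one D'"
    using gs by (auto simp: game_state_def boundary_cycles_conv)
  obtain \<iota> where gg: "g \<le> g'" and \<iota>: "embeds (arcs D) (nxt D) (arcs D') (nxt D') \<iota>"
    and \<iota>\<chi>: "\<And>e e'. e \<in> arcs D \<Longrightarrow> e' \<in> arcs D \<Longrightarrow> \<chi>' (\<iota> e) = \<chi>' (\<iota> e') \<Longrightarrow> \<chi> e = \<chi> e'"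
    using minor[unfolded minor_state_iff] by blast
  obtain x y where xy: "dummies D = (x, y)" by fastforce
  obtain v' w' where m': "m' = (v', w')" by fastforce
  note dummies = dummies_fresh[OF fin_digraph.finite_verts[OF D(1)] xy]
  obtain v w where vw: "v \<in> verts D \<union> {x, y}" "w \<in> verts D \<union> {x, y}"
    and sub: "\<And>f f' F F'. f \<notin> arcs D \<Longrightarrow> f' \<notin> arcs D \<Longrightarrow> f \<noteq> f' \<Longrightarrow>
       F \<notin> arcs D' \<Longrightarrow> F' \<notin> arcs D' \<Longrightarrow> F \<noteq> F' \<Longrightarrow>
       \<exists>\<kappa>. (\<forall>e \<in> arcs D. \<kappa> e = \<iota> e) \<and> (\<kappa> f = F \<and> \<kappa> f' = F' \<or> \<kappa> f = F' \<and> \<kappa> f' = F) \<and>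
         embeds (insert f (insert f' (arcs D))) (subdivided D v w f f')
           (insert F (insert F' (arcs D'))) (subdivided D' v' w' F F') \<kappa>"
    by (rule subdivided_embeds[OF D D' \<iota> dummies, of v' w']) (rule that; blast)
  \<comment> \<open>One cut of the larger state, with arbitrary fresh names, serves all answers of
    Cutter; only the choice of the parts to keep depends on the answer.\<close>
  obtain Q Q' E' \<chi>2' where cut': "cut D' \<chi>' v' w' Q Q' E' \<chi>2'" using cut_exists[OF D'(1)] by blast
  obtain v1' v2' w1' w2' F F' l' where
    fr': "fresh_split D' v' w' v1' v2' w1' w2'" "F \<notin> arcs D'" "F' \<notin> arcs D'" "F \<noteq> F'"
    and l': "l' \<notin> \<chi>' ` arcs D'"
    and Q: "Q = component (split_points D' v' w' v1' v2' w1' w2') v1'"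
      "Q' = component (split_points D' v' w' v1' v2' w1' w2') v2'"
    and E': "E' = add_edge (add_edge (split_points D' v' w' v1' v2' w1' w2') F w2' v1') F' v2' w1'"
    and \<chi>2': "\<chi>2' = \<chi>'(F := l', F' := l')"
    using cut' by (auto simp: cut_def Let_def)
  note c' = D' fr'
  have E'A: "arcs E' = insert F (insert F' (arcs D'))" unfolding E' by (rule cut_E_arcs[OF c'])
  have ac': "arc_cycles E'" unfolding E' by (rule cut_arc_cycles[OF c'])
  let ?O' = "\<Union>(other_components D' v' w')"
  let ?orb' = "(steps (nxt E') (arcs E'))\<^sup>*"
  show ?thesis
  proof (rule that[of "(v, w)"])
    show "(v, w) \<in> marker_choices (D, \<chi>, g)" using vw xy by (auto simp: marker_choices_def Let_def)
    fix K h s assume turn: "cutter_turn (D, \<chi>, g) (v, w) K h s"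
    let ?goal = "\<lambda>s. \<exists>s'. cutter_turn (D', \<chi>', g') (v', w') (other_components D' v' w') g' s' \<and> minor_state s s'"
    have main: "(same_component D v w \<longleftrightarrow> same_component D' v' w') \<and>
        (same_component D v w \<longrightarrow> K \<subseteq> other_components D v w \<longrightarrow>
          (1 \<le> g \<longrightarrow> ?goal (E \<restriction> (\<Union>K \<union> P \<union> P'), \<chi>2, g - 1)) \<and>
          (h \<le> g \<longrightarrow> ?goal (E \<restriction> (\<Union>K \<union> P), \<chi>2, h)) \<and>
          (h \<le> g \<longrightarrow> ?goal (E \<restriction> (\<Union>K \<union> P'), \<chi>2, h))) \<and>
        (\<not> same_component D v w \<longrightarrow> ?goal (E, \<chi>2, g))"
      if cut: "cut D \<chi> v w P P' E \<chi>2" for P P' E \<chi>2 h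
    proof -
      obtain v1 v2 w1 w2 f f' l where
        fr: "fresh_split D v w v1 v2 w1 w2" "f \<notin> arcs D" "f' \<notin> arcs D" "f \<noteq> f'"
        and l: "l \<notin> \<chi> ` arcs D"
        and P: "P = component (split_points D v w v1 v2 w1 w2) v1"
          "P' = component (split_points D v w v1 v2 w1 w2) v2"
        and E: "E = add_edge (add_edge (split_points D v w v1 v2 w1 w2) f w2 v1) f' v2 w1"
        and \<chi>2: "\<chi>2 = \<chi>(f := l, f' := l)"
        using cut by (auto simp: cut_def Let_def)
      note c = D fr
      have EA: "arcs E = insert f (insert f' (arcs D))" unfolding E by (rule cut_E_arcs[OF c])
      have ac: "arc_cycles E" unfolding E by (rule cut_arc_cycles[OF c])
      let ?orb = "(steps (nxt E) (arcs E))\<^sup>*"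
      obtain \<kappa> where \<kappa>: "\<And>e. e \<in> arcs D \<Longrightarrow> \<kappa> e = \<iota> e" "\<kappa> f = F \<and> \<kappa> f' = F' \<or> \<kappa> f = F' \<and> \<kappa> f' = F"
        and \<kappa>sub: "embeds (arcs E) (subdivided D v w f f') (arcs E') (subdivided D' v' w' F F') \<kappa>"
        using sub[OF fr(2-4) fr'(2-4)] unfolding EA E'A by blast
      \<comment> \<open>The exchange is symmetric in the two arcs, so direct and crosswise matching
        lead to the same permutation.\<close>
      have "swap_images n (\<kappa> f) (\<kappa> f') = swap_images n F F'" for n
        using \<kappa>(2) swap_images_commute by metis
      then have swapped: "embeds (arcs E) (swap_images (subdivided D v w f f') f f')
          (arcs E') (swap_images (subdivided D' v' w' F F') F F') \<kappa>"
        using embeds_swap_images[OF \<kappa>sub, of f f'] by (simp add: EA)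
      have nE: "swap_images (subdivided D v w f f') f f' e = nxt E e" if "e \<in> arcs E" for e
        using nxt_cut[OF c, folded E, OF that] by simp
      have nE': "swap_images (subdivided D' v' w' F F') F F' e = nxt E' e" if "e \<in> arcs E'" for e
        using nxt_cut[OF c', folded E', OF that] by simp
      from swapped have \<kappa>E: "embeds (arcs E) (nxt E) (arcs E') (nxt E') \<kappa>"
        by (rule iffD1[OF embeds_cong, rotated 2]) (erule nE, erule nE')
      have \<iota>in: "\<iota> e \<in> arcs D'" if "e \<in> arcs D" for e using \<iota> that by (auto simp: embeds_def)
      have lab_new: "\<chi>2' (\<kappa> e) = l' \<longleftrightarrow> e \<in> {f, f'}" if e: "e \<in> arcs E" for e
      proof (cases "e \<in> {f, f'}")
        case True
        then show ?thesis using \<kappa>(2) by (auto simp: \<chi>2')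
      next
        case False
        then have eD: "e \<in> arcs D" using e by (auto simp: EA)
        then have "\<chi>' (\<iota> e) \<noteq> l'" using \<iota>in l' by auto
        then show ?thesis using False \<kappa>(1)[OF eD] \<iota>in[OF eD] fr' by (auto simp: \<chi>2')
      qed
      have lab: "\<chi>2 e = \<chi>2 e2" if e: "e \<in> arcs E" "e2 \<in> arcs E" "\<chi>2' (\<kappa> e) = \<chi>2' (\<kappa> e2)" for e e2
      proof (cases "e \<in> {f, f'}")
        case True
        then have "e2 \<in> {f, f'}" using lab_new e by metis
        then show ?thesis using True by (auto simp: \<chi>2)
      next
        case False
        then have e2: "e2 \<notin> {f, f'}" using lab_new e by metis
        with False have eD: "e \<in> arcs D" "e2 \<in> arcs D" using e by (auto simp: EA)
        then have "\<chi>' (\<iota> e) = \<chi>' (\<iota> e2)"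
          using e(3) \<kappa>(1) \<iota>in[OF eD(1)] \<iota>in[OF eD(2)] fr' by (auto simp: \<chi>2' split: if_splits)
        then have "\<chi> e = \<chi> e2" by (rule \<iota>\<chi>[OF eD])
        then show ?thesis using False e2 by (simp add: \<chi>2)
      qed
      have ff: "f \<in> arcs E" "f' \<in> arcs E" by (auto simp: EA)
      have orb: "(\<kappa> e, \<kappa> e2) \<in> ?orb' \<longleftrightarrow> (e, e2) \<in> ?orb" if "e \<in> arcs E" "e2 \<in> arcs E" for e e2
        using embeds_orbit[OF \<kappa>E nxt(1)[OF ac]] that by blast
      have \<kappa>in: "\<kappa> e \<in> arcs E'" if "e \<in> arcs E" for e using \<kappa>E that by (auto simp: embeds_def)
      have "(F, F') \<in> ?orb' \<longleftrightarrow> (f, f') \<in> ?orb"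
        using orb[OF ff] orb[OF ff(2,1)] orbit_sym[OF _ bij_nxt[OF ac]] orbit_sym[OF _ bij_nxt[OF ac']]
          ac ac' \<kappa>(2) unfolding arc_cycles_def by metis
      then have same: "same_component D v w \<longleftrightarrow> same_component D' v' w'"
        using same_component_iff_orbit[OF c, folded E] same_component_iff_orbit[OF c', folded E'] by simp
      have ga: "?goal (E \<restriction> (\<Union>K \<union> P \<union> P'), \<chi>2, g - 1)"
        if sc: "same_component D v w" and K: "K \<subseteq> other_components D v w" and g: "1 \<le> g"
      proof (intro exI conjI)
        show "cutter_turn (D', \<chi>', g') (v', w') (other_components D' v' w') g' (E' \<restriction> (?O' \<union> Q \<union> Q'), \<chi>2', g' - 1)"
          by (rule cutter_turn.move_a[OF cut']) (use sc same g gg in auto)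
        show "minor_state (E \<restriction> (\<Union>K \<union> P \<union> P'), \<chi>2, g - 1) (E' \<restriction> (?O' \<union> Q \<union> Q'), \<chi>2', g' - 1)"
        proof (rule minor_state_restrict[OF \<kappa>E lab ac ac'])
          show "closed_in E (\<Union>K \<union> P \<union> P')"
            using cut_K_closed(1)[OF c sc K] cut_P_closed[OF c sc] cut_P'_closed[OF c sc]
            unfolding E P by (intro closed_un)
          show "closed_in E' (?O' \<union> Q \<union> Q')"
            using cut_K_closed(1)[OF c' _ subset_refl] cut_P_closed[OF c'] cut_P'_closed[OF c'] sc same
            unfolding E' Q by (intro closed_un) auto
          fix e assume "e \<in> arcs (E \<restriction> (\<Union>K \<union> P \<union> P'))"
          then have "\<kappa> e \<in> arcs E'" using \<kappa>in by (simp add: arcs_induce)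
          then show "\<kappa> e \<in> arcs (E' \<restriction> (?O' \<union> Q \<union> Q'))"
            using cut_keep_a[OF c', folded E' Q] sc same by simp
        qed (use gg in auto)
      qed
      \<comment> \<open>The new arc \<open>d\<close> is the one whose cycle Cutter discards. Its
        image decides the answer: (b) discards the cycle of \<open>F'\<close> and (c) that of
        \<open>F\<close>, so crosswise matching interchanges the two moves.\<close>
      have keep: "?goal (E \<restriction> U, \<chi>2, h)"
        if sc: "same_component D v w" and U: "closed_in E U" and d: "d \<in> {f, f'}"
          and h: "h \<le> g" and Ud: "\<And>e. e \<in> arcs (E \<restriction> U) \<Longrightarrow> (d, e) \<notin> ?orb" for U d
      proof -
        have sc': "same_component D' v' w'" using sc same by simp
        have nd: "(\<kappa> d, \<kappa> e) \<notin> ?orb'" if "e \<in> arcs (E \<restriction> U)" for e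
          using Ud[OF that] orb[of d e] d ff that by (auto simp: arcs_induce)
        have in': "\<kappa> e \<in> arcs E'" if "e \<in> arcs (E \<restriction> U)" for e
          using that \<kappa>in by (simp add: arcs_induce)
        have cl': "closed_in E' (?O' \<union> Q)" "closed_in E' (?O' \<union> Q')"
          using cut_K_closed(1)[OF c' sc' subset_refl] cut_P_closed[OF c' sc'] cut_P'_closed[OF c' sc']
          unfolding E' Q by (auto intro: closed_un)
        have "\<kappa> d = F \<or> \<kappa> d = F'" using d \<kappa>(2) by auto
        then show ?thesis
        proof
          assume \<kappa>d: "\<kappa> d = F'"
          show ?thesis
          proof (intro exI conjI)
            show "cutter_turn (D', \<chi>', g') (v', w') (other_components D' v' w') g' (E' \<restriction> (?O' \<union> Q), \<chi>2', g')"
              by (rule cutter_turn.move_b[OF cut' sc']) auto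
            show "minor_state (E \<restriction> U, \<chi>2, h) (E' \<restriction> (?O' \<union> Q), \<chi>2', g')"
              using cut_keep_b[OF c' sc', folded E' Q] in' nd h gg \<kappa>d
              by (intro minor_state_restrict[OF \<kappa>E lab ac ac' U cl'(1)]) auto
          qed
        next
          assume \<kappa>d: "\<kappa> d = F"
          show ?thesis
          proof (intro exI conjI)
            show "cutter_turn (D', \<chi>', g') (v', w') (other_components D' v' w') g' (E' \<restriction> (?O' \<union> Q'), \<chi>2', g')"
              by (rule cutter_turn.move_c[OF cut' sc']) auto
            show "minor_state (E \<restriction> U, \<chi>2, h) (E' \<restriction> (?O' \<union> Q'), \<chi>2', g')"
              using cut_keep_c[OF c' sc', folded E' Q] in' nd h gg \<kappa>d
              by (intro minor_state_restrict[OF \<kappa>E lab ac ac' U cl'(2)]) auto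
          qed
        qed
      qed
      have gb: "?goal (E \<restriction> (\<Union>K \<union> P), \<chi>2, h)"
        if sc: "same_component D v w" and K: "K \<subseteq> other_components D v w" and h: "h \<le> g"
      proof (rule keep[OF sc _ _ h, of _ f'])
        show "closed_in E (\<Union>K \<union> P)"
          unfolding E P by (rule closed_un[OF cut_K_closed(1)[OF c sc K] cut_P_closed[OF c sc]])
      qed (use cut_restrict_b[OF c sc K, folded E P] in auto)
      have gc: "?goal (E \<restriction> (\<Union>K \<union> P'), \<chi>2, h)"
        if sc: "same_component D v w" and K: "K \<subseteq> other_components D v w" and h: "h \<le> g"
      proof (rule keep[OF sc _ _ h, of _ f])
        show "closed_in E (\<Union>K \<union> P')"
          unfolding E P by (rule closed_un[OF cut_K_closed(1)[OF c sc K] cut_P'_closed[OF c sc]])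
      qed (use cut_restrict_c[OF c sc K, folded E P] in auto)
      have gd: "?goal (E, \<chi>2, g)" if "\<not> same_component D v w"
      proof (intro exI conjI)
        show "cutter_turn (D', \<chi>', g') (v', w') (other_components D' v' w') g' (E', \<chi>2', g')"
          by (rule cutter_turn.move_d[OF cut']) (use that same in simp)
        show "minor_state (E, \<chi>2, g) (E', \<chi>2', g')"
          unfolding minor_state_iff using gg \<kappa>E lab by blast
      qed
      show ?thesis using same ga gb gc gd by blast
    qed
    from turn have "?goal s"
    proof cases
      case (move_a P P' E \<chi>2)
      then show ?thesis using main[OF move_a(2)] by simp
    next
      case (move_b P P' E \<chi>2)
      then show ?thesis using main[OF move_b(2)] by simp
    next
      case (move_c P P' E \<chi>2)
      then show ?thesis using main[OF move_c(2)] by simp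
    next
      case (move_d P P' E \<chi>2)
      then show ?thesis using main[OF move_d(2)] by simp
    qed
    then show "\<exists>s'. cutter_turn (D', \<chi>', g') m' (other_components D' (fst m') (snd m')) g' s' \<and> minor_state s s'"
      by (simp add: m')
  qed
qed

section \<open>From turns to plays\<close>

text \<open>Both the strategy and the rule for a turn look only at the states before it, so a play
  may be cut off anywhere.\<close>

lemma play_prefix:
  assumes "play R \<sigma> g\<^sub>0 H" "s \<in> set H"
  shows "\<exists>H'. play R \<sigma> g\<^sub>0 H' \<and> last H' = s"
  using assms
proof (induction rule: play.induct)
  case play_start
  then show ?case using play.play_start by fastforce
next
  case (play_turn H s')
  then show ?case using play.play_turn by (cases "s \<in> set H") fastforce+
qed

lemma marker_keeps_minor:
  fixes s :: "('v::infinite, 'e::infinite, 'l::infinite) config"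
  assumes "game_state s" "play restricted_cutter \<sigma> g\<^sub>0 H'" "minor_state s (last H')"
  obtains m where "m \<in> marker_choices s"
    "\<And>K h s2. cutter_turn s m K h s2 \<Longrightarrow>
       \<exists>H2. play restricted_cutter \<sigma> g\<^sub>0 H2 \<and> minor_state s2 (last H2)"
proof -
  obtain D \<chi> g where s: "s = (D, \<chi>, g)" by (cases s)
  obtain D' \<chi>' g' where s': "last H' = (D', \<chi>', g')" by (cases "last H'")
  have H': "H' \<noteq> []" "\<And>s. s \<in> set H' \<Longrightarrow> game_state s" using play_game_state[OF assms(2)] by auto
  then have gs': "game_state (D', \<chi>', g')" using s' last_in_set by metis
  show ?thesis
  proof (rule marker_simulates[OF assms(1)[unfolded s] gs' assms(3)[unfolded s s'], of "\<sigma> H'"])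
    fix m assume m: "m \<in> marker_choices (D, \<chi>, g)"
      and sim: "\<And>K h s. cutter_turn (D, \<chi>, g) m K h s \<Longrightarrow>
        \<exists>s'. cutter_turn (D', \<chi>', g') (\<sigma> H') (other_components D' (fst (\<sigma> H')) (snd (\<sigma> H'))) g' s' \<and>
          minor_state s s'"
    show ?thesis
    proof (rule that)
      show "m \<in> marker_choices s" using m s by simp
      fix K h s2 assume "cutter_turn s m K h s2"
      then obtain s2' where
        turn: "cutter_turn (D', \<chi>', g') (\<sigma> H') (other_components D' (fst (\<sigma> H')) (snd (\<sigma> H'))) g' s2'"
        and min: "minor_state s2 s2'"
        using sim unfolding s by blast
      show "\<exists>H2. play restricted_cutter \<sigma> g\<^sub>0 H2 \<and> minor_state s2 (last H2)"
      proof (cases "\<exists>s0 \<in> set H'. \<exists>r. reduction r s0 \<and> equivalent s2' r")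
        case True
        then obtain s0 r where s0: "s0 \<in> set H'" "reduction r s0" "equivalent s2' r" by blast
        then have "minor_state s2' s0"
          using equivalent_reduction_minor_state cutter_turn_game_state[OF turn gs'] H'(2) by blast
        then have "minor_state s2 s0" using min minor_state_trans by blast
        then show ?thesis using play_prefix[OF assms(2) s0(1)] by metis
      next
        case False
        then have "restricted_cutter H' (\<sigma> H') s2'" using turn by (simp add: restricted_cutter_def s')
        then have "play restricted_cutter \<sigma> g\<^sub>0 (H' @ [s2'])" using assms(2) by (rule play.play_turn[rotated])
        then show ?thesis using min by (metis last_snoc)
      qed
    qed
  qed
qed

theorem theorem4p5:
  fixes g\<^sub>0 t :: nat
  assumes "\<exists>\<sigma> :: ('v::infinite, 'e::infinite, 'l::infinite) strategy.
             limits_value restricted_cutter \<sigma> g\<^sub>0 t"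
  shows "\<exists>\<sigma> :: ('v, 'e, 'l) strategy. limits_value unrestricted_cutter \<sigma> g\<^sub>0 t"
proof -
  obtain \<sigma> :: "('v, 'e, 'l) strategy" where \<sigma>: "limits_value restricted_cutter \<sigma> g\<^sub>0 t" using assms by blast
  let ?dom = "\<lambda>s. \<exists>H'. play restricted_cutter \<sigma> g\<^sub>0 H' \<and> minor_state s (last H')"
  let ?ok = "\<lambda>s m. m \<in> marker_choices s \<and> (\<forall>K h s2. cutter_turn s m K h s2 \<longrightarrow> ?dom s2)"
  \<comment> \<open>This strategy looks at the last state only. The accompanying restricted play is
    not recorded but merely asserted to exist by \<open>?dom\<close>, so it may be replaced by
    another one at each turn.\<close>
  define \<tau> :: "('v, 'e, 'l) strategy" where "\<tau> H = (SOME m. ?ok (last H) m)" for H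
  have \<tau>: "?ok (last H) (\<tau> H)" if gs: "game_state (last H)" and dom: "?dom (last H)" for H
  proof -
    obtain H' where "play restricted_cutter \<sigma> g\<^sub>0 H'" "minor_state (last H) (last H')" using dom by blast
    from marker_keeps_minor[OF gs this] have "\<exists>m. ?ok (last H) m" by metis
    then show ?thesis unfolding \<tau>_def by (rule someI_ex)
  qed
  have small: "state_value s \<le> t" if s: "?dom s" for s
  proof -
    obtain H' where H': "play restricted_cutter \<sigma> g\<^sub>0 H'" "minor_state s (last H')" using s by blast
    have ne: "last H' \<in> set H'" and gs: "game_state (last H')" using play_game_state[OF H'(1)] by auto
    obtain D \<chi> g where s: "s = (D, \<chi>, g)" by (cases s)
    obtain D' \<chi>' g' where s': "last H' = (D', \<chi>', g')" by (cases "last H'")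
    have "finite (arcs D')" using gs by (auto simp: s' game_state_def boundary_cycles_def fin_digraph.finite_arcs)
    then have "state_value s \<le> state_value (last H')" using minor_state_value H'(2) unfolding s s' by blast
    also have "\<dots> \<le> t" using \<sigma> H'(1) ne by (auto simp: limits_value_def)
    finally show ?thesis .
  qed
  have inv: "\<forall>s \<in> set H. ?dom s" if "play unrestricted_cutter \<tau> g\<^sub>0 H" for H
    using that
  proof (induction rule: play.induct)
    case play_start
    have "play restricted_cutter \<sigma> g\<^sub>0 [initial_state g\<^sub>0]" by (rule play.play_start)
    then show ?case using minor_state_refl by (metis last.simps list.set_cases empty_iff list.set(1) set_ConsD)
  next
    case (play_turn H s)
    have "H \<noteq> []" "game_state (last H)" using play_game_state[OF play_turn(1)] by auto
    then have "?ok (last H) (\<tau> H)" using play_turn(3) by (intro \<tau>) auto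
    moreover obtain K h where "cutter_turn (last H) (\<tau> H) K h s"
      using play_turn(2) by (auto simp: unrestricted_cutter_def)
    ultimately have "?dom s" by blast
    then show ?case using play_turn(3) by auto
  qed
  have "limits_value unrestricted_cutter \<tau> g\<^sub>0 t"
    unfolding limits_value_def
  proof (intro allI impI conjI ballI)
    fix H assume H: "play unrestricted_cutter \<tau> g\<^sub>0 H"
    have "H \<noteq> []" "game_state (last H)" using play_game_state[OF H] by auto
    then show "\<tau> H \<in> marker_choices (last H)" using inv[OF H] \<tau> by auto
    show "state_value s \<le> t" if "s \<in> set H" for s using inv[OF H] that small by blast
  qed
  then show ?thesis by blast
qed

end
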